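(* Let $\alpha\in(0,1]$, $\lambda>0$, $\mu>0$ with $\lambda\neq\mu$, and $i\in\mathbb{N}\cup\{0\}$. The state probabilities $p_k^\alpha(t)=\Pr\{N^\alpha(t)=k\mid N^\alpha(0)=i\}$, $k\ge0$, $t\ge0$, of the fractional M/M/1 queue with parameter $\alpha$, arrival rate $\lambda$, service rate $\mu$ and $i$ initial customers are $$\begin{aligned} p_k^\alpha(t)={}&\left(1-\frac{\lambda}{\mu}\right)\left(\frac{\lambda}{\mu}\right)^k\\ &+\left(\frac{\lambda}{\mu}\right)^k\sum_{r=0}^\infty\sum_{m=0}^{k+r+i}\frac{r-m}{r+m}\binom{r+m}{r}\lambda^r\mu^{m-1}t^{\alpha(r+m)-\alpha}E_{\alpha,\alpha(r+m)-\alpha+1}^{\,r+m}\left[-(\lambda+\mu)t^\alpha\right]\\ &+\sum_{r=0}^\infty\left[\binom{k+2r-i}{r}-\binom{k+2r-i}{k+r}\right]\lambda^{k+r-i}\mu^r t^{\alpha(k+2r-i)}E_{\alpha,\alpha(k+2r-i)+1}^{\,k+2r-i+1}\left[-(\lambda+\mu)t^\alpha\right], \end{aligned}$$ where $$E_{\beta,\gamma}^\delta(w)=\sum_{r=0}^\infty\frac{(\delta)_r\,w^r}{r!\,\Gamma(\beta r+\gamma)}=\sum_{r=0}^\infty\frac{w^r\,\Gamma(\delta+r)}{r!\,\Gamma(\beta r+\gamma)\Gamma(\delta)},\qquad w,\gamma,\beta,\delta\in\mathbb{C},\ \Re(\beta)>0,$$ is the generalized Mittag--Leffler function.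
   Context: For $\alpha\in(0,1)$ the Caputo fractional derivative is $D_t^\alpha f(t)=\frac{1}{\Gamma(1-\alpha)}\int_0^t (t-y)^{-\alpha} f'(y)\,\mathrm dy$, and $D_t^1=\mathrm d/\mathrm dt$. The fractional M/M/1 queue $N^\alpha(t)$, $t\ge0$, with parameter $\alpha\in(0,1]$, arrival rate $\lambda>0$, service rate $\mu>0$ and $i\ge 0$ initial customers, is defined through its state probabilities $p_k^\alpha(t)=\Pr\{N^\alpha(t)=k\mid N^\alpha(0)=i\}$, $k\ge0$ (a probability distribution on $\{0,1,2,\dots\}$ for each $t$), which solve $$\begin{cases} D_t^\alpha p_k^\alpha(t)=-(\lambda+\mu)p_k^\alpha(t)+\lambda p_{k-1}^\alpha(t)+\mu p_{k+1}^\alpha(t), & k\ge1,\\ D_t^\alpha p_0^\alpha(t)=-\lambda p_0^\alpha(t)+\mu p_1^\alpha(t),\\ p_k^\alpha(0)=\delta_{k,i},\end{cases}$$ with $\delta_{k,i}$ the Kronecker delta. Conventions: $(\delta)_r=\delta(\delta+1)\cdots(\delta+r-1)$ is the Pochhammer symbol. In the double sum the term $r=m=0$ is zero (it comes from $(r-m)(r+m-1)!/(r!\,m!)$ with factor $r-m=0$). In the last sum $\binom{k+2r-i}{r}$ stands for $\frac{(k+2r-i)!}{r!\,(k+r-i)!}$ and $\binom{k+2r-i}{k+r}$ for $\frac{(k+2r-i)!}{(k+r)!\,(r-i)!}$, where $1/n!=0$ for negative integers $n$: the first is $0$ when $k+r-i<0$, the second is $0$ when $r-i<0$, and a term whose bracket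 vanishes in this way (in particular any with $k+2r-i<0$) is zero. At $t=0$, $t^0=1$. *)

theory Defs
  imports "HOL-Probability.Probability"
begin

text \<open>
  The Caputo operator of order \<open>\<alpha> \<in> (0,1]\<close>. Since \<^term>\<open>deriv\<close> and the Lebesgue integral are
  total, the value is meaningful only together with \<open>caputo_differentiable\<close>. Differentiability at
  \<open>0\<close> is not required: solutions of fractional equations with \<open>\<alpha> < 1\<close> behave like
  \<open>f 0 + c * t powr \<alpha>\<close> there. The values of the integrand at the endpoints are irrelevant.
\<close>

definition caputo_deriv :: "real \<Rightarrow> (real \<Rightarrow> real) \<Rightarrow> real \<Rightarrow> real" where
  "caputo_deriv \<alpha> f t =
     (if \<alpha> = 1 then deriv f t
      else 1 / Gamma (1 - \<alpha>) * (LBINT y:{0..t}. (t - y) powr (- \<alpha>) * deriv f y))"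

definition caputo_differentiable :: "real \<Rightarrow> (real \<Rightarrow> real) \<Rightarrow> real \<Rightarrow> bool" where
  "caputo_differentiable \<alpha> f t \<longleftrightarrow>
     continuous_on {0..t} f \<and>
     (\<forall>y\<in>{0<..t}. f field_differentiable at y) \<and>
     (\<alpha> \<noteq> 1 \<longrightarrow> set_integrable lborel {0..t} (\<lambda>y. (t - y) powr (- \<alpha>) * deriv f y))"

definition state_prob :: "'a measure \<Rightarrow> (real \<Rightarrow> 'a \<Rightarrow> nat) \<Rightarrow> nat \<Rightarrow> nat \<Rightarrow> real \<Rightarrow> real" where
  "state_prob M N i k t = \<P>(\<omega> in M. N t \<omega> = k \<bar> N 0 \<omega> = i)"

text \<open>
  \<open>N t\<close> is used only for \<open>t \<ge> 0\<close>. The equations are imposed for \<open>t > 0\<close>: for \<open>\<alpha> < 1\<close> the Caputo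
  integral at \<open>t = 0\<close> is over a null set. The link to the initial condition is the continuity at \<open>0\<close>
  contained in \<open>caputo_differentiable\<close>.
\<close>

definition fractional_MM1_queue ::
  "'a measure \<Rightarrow> (real \<Rightarrow> 'a \<Rightarrow> nat) \<Rightarrow> real \<Rightarrow> real \<Rightarrow> real \<Rightarrow> nat \<Rightarrow> bool" where
  "fractional_MM1_queue M N \<alpha> lam mu i \<longleftrightarrow>
     prob_space M \<and>
     (\<forall>t\<ge>0. N t \<in> measurable M (count_space UNIV)) \<and>
     \<P>(\<omega> in M. N 0 \<omega> = i) > 0 \<and>
     (let p = state_prob M N i in
       (\<forall>k. \<forall>t>0. caputo_differentiable \<alpha> (p k) t) \<and>
       (\<forall>k\<ge>1. \<forall>t>0. caputo_deriv \<alpha> (p k) t =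
           - (lam + mu) * p k t + lam * p (k - 1) t + mu * p (k + 1) t) \<and>
       (\<forall>t>0. caputo_deriv \<alpha> (p 0) t = - lam * p 0 t + mu * p 1 t) \<and>
       (\<forall>k. p k 0 = (if k = i then 1 else 0)))"

text \<open>
  The generalized Mittag-Leffler function \<open>E\<^sub>\<beta>\<^sub>,\<^sub>\<gamma>\<^sup>\<delta>(w)\<close>, for real or complex arguments. At the poles
  of \<^term>\<open>Gamma\<close> the quotient is \<open>0\<close> by the convention \<open>x / 0 = 0\<close>, in agreement with
  \<open>1 / \<Gamma> = 0\<close> there.
\<close>

definition mittag_leffler :: "'a::Gamma \<Rightarrow> 'a \<Rightarrow> 'a \<Rightarrow> 'a \<Rightarrow> 'a" where
  "mittag_leffler \<beta> \<gamma> \<delta> w =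
     (\<Sum>r. pochhammer \<delta> r * w ^ r / (fact r * Gamma (\<beta> * of_nat r + \<gamma>)))"

lemma mittag_leffler_altdef:
  fixes \<delta> :: "'a::Gamma"
  assumes "\<delta> \<notin> \<int>\<^sub>\<le>\<^sub>0"
  shows "mittag_leffler \<beta> \<gamma> \<delta> w =
    (\<Sum>r. w ^ r * Gamma (\<delta> + of_nat r) / (fact r * Gamma (\<beta> * of_nat r + \<gamma>) * Gamma \<delta>))"
  using assms by (simp add: mittag_leffler_def pochhammer_Gamma mult_ac)

text \<open>\<open>0 powr 0 = 0\<close> in the library, whereas here \<open>0\<^sup>0 = 1\<close>.\<close>

definition time_pow :: "real \<Rightarrow> real \<Rightarrow> real" where
  "time_pow t x = (if x = 0 then 1 else t powr x)"

text \<open>\<open>1 / n!\<close>, extended by \<open>0\<close> to the negative integers.\<close>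

definition inv_fact :: "int \<Rightarrow> real" where
  "inv_fact n = (if n < 0 then 0 else 1 / fact (nat n))"

text \<open>
  \<open>n! / (j! (n - j)!)\<close>; it vanishes for \<open>n < j\<close>, in particular for all negative \<open>n\<close>. It therefore
  differs from \<^term>\<open>(gchoose)\<close> at negative \<open>n\<close>.
\<close>

definition int_binomial :: "int \<Rightarrow> nat \<Rightarrow> real" where
  "int_binomial n j = fact (nat n) * inv_fact (int j) * inv_fact (n - int j)"

end

theory Submission
  imports Defs
begin

text \<open>
  Integrating the Caputo equation (Fubini and the Beta integral) gives the Volterra equation
  \<open>p = p 0 + J\<^sup>\<alpha> (G p)\<close>, where the generator \<open>G\<close> is bounded by \<open>2 (\<lambda> + \<mu>)\<close> on bounded sequences.
  Iterating it gives \<open>p k t = (\<Sum>n. (G\<^sup>n \<delta>\<^sub>i) k * t\<^bsup>\<alpha>n\<^esup> / \<Gamma> (\<alpha> n + 1))\<close>, so \<open>\<alpha>\<close> enters only through the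
  functions \<open>t\<^bsup>\<alpha>n\<^esup> / \<Gamma> (\<alpha> n + 1)\<close> and the claim becomes an identity between coefficients. Put
  \<open>a = \<lambda> + \<mu>\<close>. Writing \<open>G = - a + H\<close> and expanding, one gets \<open>p k t = (\<Sum>l. (H\<^sup>l \<delta>\<^sub>i) k * F l)\<close>
  with \<open>F l = t\<^bsup>\<alpha>l\<^esup> E\<^bsup>l+1\<^esup>(- a t\<^sup>\<alpha>)\<close>. Both double sums of the theorem are combinations of the
  same functions \<open>F l\<close> (with \<open>l = r + m - 1\<close> and \<open>l = k + 2 r - i\<close>), and the constant is
  \<open>1 = (\<Sum>l. a\<^sup>l F l)\<close>. What remains is the reflection principle for the weighted path counts
  \<open>(H\<^sup>l \<delta>\<^sub>i) k\<close>, verified through Pascal's rule.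
\<close>

subsection \<open>Weighted path counts\<close>

text \<open>Extending the binomial by 0 to negative lower indices makes Pascal's rule and the
  symmetry hold for every integer \<open>j\<close>, which the shifts below rely on.\<close>

definition int_choose :: "nat \<Rightarrow> int \<Rightarrow> real" where
  "int_choose n j = (if j < 0 then 0 else real (n choose nat j))"

lemma int_choose_neg [simp]: "j < 0 \<Longrightarrow> int_choose n j = 0"
  and int_choose_of_nat [simp]: "int_choose n (int r) = real (n choose r)"
  and int_choose_gt [simp]: "int n < j \<Longrightarrow> int_choose n j = 0"
  by (auto simp: int_choose_def binomial_eq_0)

lemma int_choose_Suc: "int_choose (Suc n) j = int_choose n j + int_choose n (j - 1)"
proof (cases "j \<le> 0")
  case True
  then show ?thesis by (cases "j = 0") (auto simp: int_choose_def)
next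
  case False
  define m where "m = nat (j - 1)"
  have "j = int (Suc m)" using False by (simp add: m_def)
  then show ?thesis by (simp add: int_choose_def nat_add_distrib)
qed

lemma int_choose_symmetric: "int_choose n (int n - j) = int_choose n j"
proof (cases "0 \<le> j \<and> j \<le> int n")
  case True
  then obtain r where r: "j = int r" "r \<le> n" by (metis nat_0_le of_nat_le_iff)
  then have "int n - j = int (n - r)" by simp
  then show ?thesis using r binomial_symmetric[of r n] by (simp only: int_choose_of_nat)
next
  case False
  then show ?thesis by auto
qed

text \<open>For 2 r \<le> l this is the ballot number: the number of paths with \<open>r\<close>
  down steps and \<open>l - r\<close> up steps that never go below their starting level.\<close>

definition ballot :: "nat \<Rightarrow> int \<Rightarrow> real" where
  "ballot l r = int_choose l r - int_choose l (r - 1)"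

lemma ballot_Suc: "ballot (Suc l) r = ballot l r + ballot l (r - 1)"
  by (simp add: ballot_def int_choose_Suc)

text \<open>The range ends at \<open>Suc l\<close> because \<open>ballot l (l + 1) = -1\<close>;
  there the exponent of \<open>mu\<close> is -1, hence \<open>powi\<close>. The cutoff is kept in
  the form \<open>2 * r \<le> b\<close> so that \<open>b\<close> may have either parity.\<close>

definition ballot_sum :: "real \<Rightarrow> real \<Rightarrow> nat \<Rightarrow> int \<Rightarrow> real" where
  "ballot_sum lam mu l b =
     (\<Sum>r\<le>Suc l. if 2 * int r \<le> b then ballot l (int r) * lam ^ r * mu powi (int l - int r) else 0)"

text \<open>Pascal's rule splits each summand in two. One half keeps \<open>r\<close> and gains a
  factor \<open>mu\<close>; the other replaces \<open>r\<close> by \<open>r - 1\<close>, which gains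
  a factor \<open>lam\<close> and lowers the cutoff by 2.\<close>

lemma ballot_sum_Suc:
  assumes "mu \<noteq> 0"
  shows "ballot_sum lam mu (Suc l) b = mu * ballot_sum lam mu l b + lam * ballot_sum lam mu l (b - 2)"
proof -
  let ?f = "\<lambda>r. if 2 * int r \<le> b then ballot l (int r) * lam ^ r * mu powi (int (Suc l) - int r) else 0"
  let ?g = "\<lambda>r. if 2 * int r \<le> b then ballot l (int r - 1) * lam ^ r * mu powi (int (Suc l) - int r) else 0"
  have "ballot_sum lam mu (Suc l) b = (\<Sum>r\<le>Suc (Suc l). ?f r + ?g r)"
    unfolding ballot_sum_def by (intro sum.cong refl) (simp add: ballot_Suc ring_distribs)
  also have "\<dots> = (\<Sum>r\<le>Suc (Suc l). ?f r) + (\<Sum>r\<le>Suc (Suc l). ?g r)"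
    by (simp add: sum.distrib)
  \<comment> \<open>The top summand r = l + 2 vanishes, since both binomials in
    \<open>ballot l (l + 2)\<close> are 0.\<close>
  also have "(\<Sum>r\<le>Suc (Suc l). ?f r) = (\<Sum>r\<le>Suc l. ?f r)"
    by (simp add: ballot_def)
  also have "(\<Sum>r\<le>Suc l. ?f r) = mu * ballot_sum lam mu l b"
    unfolding ballot_sum_def sum_distrib_left
  proof (intro sum.cong refl)
    fix r
    have "mu powi (int (Suc l) - int r) = mu * mu powi (int l - int r)"
      using power_int_add_1'[OF disjI1[OF assms], of "int l - int r"] by (simp add: algebra_simps)
    then show "?f r = mu * (if 2 * int r \<le> b then ballot l (int r) * lam ^ r * mu powi (int l - int r) else 0)"
      by simp
  qed
  also have "(\<Sum>r\<le>Suc (Suc l). ?g r) = ?g 0 + (\<Sum>r\<le>Suc l. ?g (Suc r))"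
    by (rule sum.atMost_Suc_shift)
  also have "?g 0 = 0" by (simp add: ballot_def)
  also have "(\<Sum>r\<le>Suc l. ?g (Suc r)) = lam * ballot_sum lam mu l (b - 2)"
    unfolding ballot_sum_def sum_distrib_left
    by (intro sum.cong refl) (auto simp: algebra_simps)
  finally show ?thesis by simp
qed

text \<open>Free paths of \<open>l\<close> steps from \<open>i\<close> to \<open>k\<close>, minus
  those to the mirror image \<open>-k\<close>. Here \<open>d\<close> is the number of down steps
  (weight \<open>mu\<close>) needed to reach \<open>k\<close>, and \<open>k + d\<close> is the
  number needed to reach \<open>-k\<close>; the weight is that of the path to \<open>k\<close> in
  both cases.\<close>

definition reflected_paths :: "real \<Rightarrow> real \<Rightarrow> nat \<Rightarrow> nat \<Rightarrow> int \<Rightarrow> real" where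
  "reflected_paths lam mu i l k =
     (if even (int l + int i - k) then
        (let d = (int l + int i - k) div 2 in
           (int_choose l d - int_choose l (k + d)) * lam powi (int l - d) * mu powi d)
      else 0)"

text \<open>
  For \<open>k \<ge> 0\<close> this is \<open>(H\<^sup>l \<delta>\<^sub>i) k\<close>. The same expression at \<open>k = -1\<close> turns the boundary equation
  at \<open>0\<close> into the interior recurrence plus \<open>\<lambda> h (-1) = \<mu> h 0\<close>.
\<close>

definition queue_paths :: "real \<Rightarrow> real \<Rightarrow> nat \<Rightarrow> nat \<Rightarrow> int \<Rightarrow> real" where
  "queue_paths lam mu i l k =
     reflected_paths lam mu i l k + (lam / mu) powi k * ballot_sum lam mu l (int l - k - int i)"

section \<open>Recurrence, boundary relation and initial value of the path counts\<close>

lemma reflected_paths_Suc: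
  assumes "lam \<noteq> 0" "mu \<noteq> 0"
  shows "reflected_paths lam mu i (Suc l) k =
           lam * reflected_paths lam mu i l (k - 1) + mu * reflected_paths lam mu i l (k + 1)"
proof (cases "even (int (Suc l) + int i - k)")
  case True
  then obtain d where d: "int (Suc l) + int i - k = 2 * d" by (elim evenE)
  \<comment> \<open>A last step up comes from \<open>k - 1\<close> with the same number of down
    steps; a last step down comes from \<open>k + 1\<close> with one fewer.\<close>
  have e1: "int l + int i - (k - 1) = 2 * d" and e2: "int l + int i - (k + 1) = 2 * (d - 1)"
    using d by auto
  have p1: "lam powi (1 + int l - d) = lam * lam powi (int l - d)"
    using power_int_add_1'[OF disjI1[OF assms(1)], of "int l - d"] by (simp add: algebra_simps)
  have p2: "mu powi d = mu * mu powi (d - 1)"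
    using power_int_add_1'[OF disjI1[OF assms(2)], of "d - 1"] by simp
  have p3: "int l - (d - 1) = int (Suc l) - d" by simp
  show ?thesis
    unfolding reflected_paths_def d e1 e2 Let_def p3 int_choose_Suc
    by (simp add: p1 p2 algebra_simps)
next
  case False
  then have "odd (int l + int i - (k - 1))" "odd (int l + int i - (k + 1))" by auto
  then show ?thesis using False by (simp add: reflected_paths_def del: of_nat_Suc)
qed

text \<open>In the correction term the prefactor exchanges the rates:
  \<open>lam * (lam / mu) powi (k - 1)\<close> is \<open>mu * (lam / mu) powi k\<close>, and
  similarly at \<open>k + 1\<close>. The recurrence of \<open>ballot_sum\<close> then fits, because
  its two cutoffs are exactly those belonging to \<open>k - 1\<close> and
  \<open>k + 1\<close>.\<close>

lemma queue_paths_Suc: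
  assumes "lam \<noteq> 0" "mu \<noteq> 0"
  shows "queue_paths lam mu i (Suc l) k =
           lam * queue_paths lam mu i l (k - 1) + mu * queue_paths lam mu i l (k + 1)"
proof -
  have nz: "lam / mu \<noteq> 0" using assms by simp
  have p1: "(lam / mu) powi k = (lam / mu) * (lam / mu) powi (k - 1)"
    using power_int_add_1'[OF disjI1[OF nz], of "k - 1"] by simp
  have p2: "(lam / mu) powi (k + 1) = (lam / mu) * (lam / mu) powi k"
    using power_int_add_1'[OF disjI1[OF nz], of k] by simp
  have s: "ballot_sum lam mu (Suc l) (int (Suc l) - k - int i)
           = mu * ballot_sum lam mu l (int l - (k - 1) - int i) + lam * ballot_sum lam mu l (int l - (k + 1) - int i)"
    by (subst ballot_sum_Suc[OF assms(2)]) (simp add: algebra_simps)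
  show ?thesis
    unfolding queue_paths_def reflected_paths_Suc[OF assms] s p2
    using assms by (simp add: p1 field_simps)
qed

lemma ballot_sum_step:
  "ballot_sum lam mu l (2 * q) = ballot_sum lam mu l (2 * q - 1) +
     (if 0 \<le> q \<and> q \<le> int l + 1 then ballot l q * lam ^ nat q * mu powi (int l - q) else 0)"
proof -
  let ?h = "\<lambda>r. ballot l (int r) * lam ^ r * mu powi (int l - int r)"
  have "ballot_sum lam mu l (2 * q) = ballot_sum lam mu l (2 * q - 1) +
      (\<Sum>r\<le>Suc l. if int r = q then ?h r else 0)"
    unfolding ballot_sum_def sum.distrib[symmetric] by (intro sum.cong refl) auto
  also have "(\<Sum>r\<le>Suc l. if int r = q then ?h r else 0) =
      (if 0 \<le> q \<and> q \<le> int l + 1 then ballot l q * lam ^ nat q * mu powi (int l - q) else 0)"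
  proof (cases "0 \<le> q")
    case True
    then obtain n where "q = int n" by (metis nat_0_le)
    then show ?thesis by (auto simp: sum.delta)
  next
    case False
    then have "\<And>r. int r \<noteq> q" by auto
    with False show ?thesis by simp
  qed
  finally show ?thesis .
qed

text \<open>The reflected part vanishes at 0 by antisymmetry. Passing from 0 to -1 raises the cutoff
  of \<open>ballot_sum\<close> by one: if the new cutoff is even, one summand enters and cancels the
  reflected part at -1; if it is odd, nothing enters and the reflected part is 0 by parity.\<close>

lemma queue_paths_boundary:
  assumes "lam \<noteq> 0" "mu \<noteq> 0"
  shows "lam * queue_paths lam mu i l (-1) = mu * queue_paths lam mu i l 0"
proof -
  have p: "(lam / mu) powi (-1) = mu / lam" by (simp add: power_int_minus)
  have r0: "reflected_paths lam mu i l 0 = 0"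
    by (simp add: reflected_paths_def Let_def)
  have "lam * reflected_paths lam mu i l (-1) + mu * ballot_sum lam mu l (int l + 1 - int i)
        = mu * ballot_sum lam mu l (int l - int i)"
  proof (cases "even (int l + 1 - int i)")
    case True
    then obtain q where q: "int l + 1 - int i = 2 * q" by (elim evenE)
    have q': "int l - int i = 2 * q - 1" using q by simp
    \<comment> \<open>At target -1 the number of down steps is \<open>l + 1 - q\<close>. By symmetry
      of the binomials the difference in \<open>reflected_paths\<close> becomes
      \<open>- ballot l q\<close>.\<close>
    have e: "int l + int i - (-1) = 2 * (int l + 1 - q)" using q by simp
    have *: "lam * reflected_paths lam mu i l (-1) =
         - (ballot l q * lam powi q * mu powi (int l + 1 - q))"
    proof -
      have "int_choose l (int l + 1 - q) = int_choose l (q - 1)"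
        using int_choose_symmetric[of l "q - 1"] by (simp add: algebra_simps)
      moreover have "int_choose l (-1 + (int l + 1 - q)) = int_choose l q"
        using int_choose_symmetric[of l "q"] by (simp add: algebra_simps)
      moreover have "lam powi q = lam * lam powi (int l - (int l + 1 - q))"
        using power_int_add_1'[OF disjI1[OF assms(1)], of "q - 1"] by simp
      ultimately show ?thesis
        unfolding reflected_paths_def e Let_def by (simp add: ballot_def algebra_simps)
    qed
    have **: "mu powi (int l + 1 - q) = mu * mu powi (int l - q)"
      using power_int_add_1'[OF disjI1[OF assms(2)], of "int l - q"] by (simp add: algebra_simps)
    show ?thesis
    proof (cases "0 \<le> q \<and> q \<le> int l + 1")
      case True
      then have "lam ^ nat q = lam powi q" by (simp add: power_int_def)
      then show ?thesis unfolding q q' ballot_sum_step[of lam mu l q] * **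
        using True by (simp add: algebra_simps)
    next
      case False
      then have "ballot l q = 0" unfolding ballot_def by auto
      then show ?thesis unfolding q q' ballot_sum_step[of lam mu l q] * by simp
    qed
  next
    case False
    then have o: "odd (int l + int i - (-1))" by auto
    obtain q where q: "int l - int i = 2 * q" using False by (metis evenE odd_add odd_one diff_add_eq)
    have e: "int l + 1 - int i = 2 * q + 1" using q by simp
    have "ballot_sum lam mu l (2 * q + 1) = ballot_sum lam mu l (2 * q)"
      unfolding ballot_sum_def by (intro sum.cong refl) auto
    then show ?thesis unfolding e q using o by (simp add: reflected_paths_def)
  qed
  then show ?thesis using assms unfolding queue_paths_def r0 p by (simp add: field_simps)
qed

text \<open>For k = i > 0 the value 1 comes from the empty path in the reflected part. For k = i = 0
  that part cancels, and the summand r = 0 of \<open>ballot_sum\<close> supplies the 1.\<close>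

lemma queue_paths_0:
  "queue_paths lam mu i 0 (int k) = (if k = i then 1 else 0)"
proof -
  have s: "ballot_sum lam mu 0 (- int k - int i) = (if k = 0 \<and> i = 0 then 1 else 0)"
    by (auto simp: ballot_sum_def ballot_def int_choose_def)
  show ?thesis
  proof (cases "even (int i - int k)")
    case True
    then obtain d where d: "int i - int k = 2 * d" by (elim evenE)
    have "reflected_paths lam mu i 0 (int k) = (int_choose 0 d - int_choose 0 (int k + d)) * lam powi - d * mu powi d"
      by (simp add: reflected_paths_def d Let_def)
    also have "\<dots> = (if k = i \<and> k \<noteq> 0 then 1 else 0)"
      using d by (cases "d = 0"; cases "int k + d = 0"; cases "d < 0"; cases "int k + d < 0") (auto simp: int_choose_def binomial_eq_0)
    finally show ?thesis unfolding queue_paths_def using s by (auto simp: d)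
  next
    case False
    then have "k \<noteq> i" by auto
    moreover from this have "\<not> (k = 0 \<and> i = 0)" by auto
    then have "ballot_sum lam mu 0 (- int k - int i) = 0" using s by simp
    ultimately show ?thesis using False by (simp add: queue_paths_def reflected_paths_def)
  qed
qed

subsection \<open>Fractional monomials and rearrangement of double series\<close>

text \<open>Log-convexity: the slope of \<open>ln Gamma\<close> on [x, x + 1], which equals
  \<open>ln x\<close>, is at most its slope on [x + 1, x + 1 + a].\<close>

lemma Gamma_ratio_ge:
  fixes x a :: real
  assumes "x > 0" "0 < a"
  shows "x powr a * Gamma (x + 1) \<le> Gamma (x + 1 + a)"
proof -
  let ?f = "ln \<circ> Gamma :: real \<Rightarrow> real"
  have "(?f (x + 1 + a) - ?f (x + 1)) / a \<ge> (?f (x + 1) - ?f x) / 1"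
    using convex_on_slope_le[OF log_convex_Gamma_real, of x "x + 1 + a" "x + 1"] assms
    by (simp add: field_simps)
  moreover have "?f (x + 1) - ?f x = ln x"
    using assms by (simp add: Gamma_plus1 ln_mult nonpos_Ints_def less_imp_neq[symmetric])
  ultimately have "?f (x + 1) + a * ln x \<le> ?f (x + 1 + a)"
    using assms by (simp add: field_simps)
  then have "exp (?f (x + 1) + a * ln x) \<le> exp (?f (x + 1 + a))" by simp
  then show ?thesis using assms by (simp add: exp_add powr_def mult.commute)
qed

text \<open>The n-fold fractional integral of the constant 1. With \<open>time_pow\<close> the case
  n = 0 is the constant 1 at t = 0 as well.\<close>

definition frac_monom :: "real \<Rightarrow> nat \<Rightarrow> real \<Rightarrow> real" where
  "frac_monom \<alpha> n t = time_pow t (\<alpha> * real n) / Gamma (\<alpha> * real n + 1)"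

lemma time_pow_nonneg [simp]: "0 \<le> time_pow t x"
  by (simp add: time_pow_def)

lemma time_pow_add:
  assumes "0 \<le> t" "0 \<le> x" "0 \<le> y"
  shows "time_pow t (x + y) = time_pow t x * time_pow t y"
  using assms by (auto simp: time_pow_def powr_add)

lemma time_pow_power:
  assumes "0 \<le> t" "0 \<le> x"
  shows "time_pow t x ^ n = time_pow t (x * real n)"
  by (induction n) (use assms in \<open>simp_all add: time_pow_add ring_distribs\<close>, simp add: time_pow_def)

lemma Gamma_mult_plus1_pos: "0 \<le> \<alpha> \<Longrightarrow> 0 < Gamma (\<alpha> * real n + 1 :: real)"
  by (simp add: Gamma_real_pos add_nonneg_pos)

lemma frac_monom_nonneg [simp]: "0 \<le> \<alpha> \<Longrightarrow> 0 \<le> frac_monom \<alpha> n t"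
  using Gamma_mult_plus1_pos[of \<alpha> n] by (simp add: frac_monom_def)

lemma frac_monom_0 [simp]: "frac_monom \<alpha> 0 t = 1"
  by (simp add: frac_monom_def time_pow_def)

lemma summable_frac_monom:
  assumes "0 < \<alpha>" "0 \<le> t"
  shows "summable (\<lambda>n. C ^ n * frac_monom \<alpha> n t)"
proof -
  \<comment> \<open>By \<open>Gamma_ratio_ge\<close>, \<open>q n\<close> dominates the quotient of
    consecutive terms; it tends to 0 for every \<open>C\<close>.\<close>
  define q where "q n = \<bar>C\<bar> * time_pow t \<alpha> * (\<alpha> * real n) powr (-\<alpha>)" for n
  have "q \<longlonglongrightarrow> \<bar>C\<bar> * time_pow t \<alpha> * 0"
    unfolding q_def using assms
    by (intro tendsto_mult tendsto_const tendsto_neg_powr filterlim_tendsto_pos_mult_at_top[OF tendsto_const]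
        filterlim_real_sequentially) auto
  then have "eventually (\<lambda>n. q n < 1/2) sequentially"
    by (intro order_tendstoD) auto
  then obtain N where N: "\<And>n. n \<ge> N \<Longrightarrow> q n < 1/2" by (auto simp: eventually_at_top_linorder)
  show ?thesis
  \<comment> \<open>Starting at \<open>Suc N\<close> ensures n > 0, so that
    \<open>Gamma_ratio_ge\<close> applies at \<alpha> n > 0.\<close>
  proof (rule summable_ratio_test[of "1/2" "Suc N"])
    fix n assume n: "Suc N \<le> n"
    then have n0: "0 < n" by simp
    define G where "G = Gamma (\<alpha> * real n + 1)"
    define G' where "G' = Gamma (\<alpha> * real n + 1 + \<alpha>)"
    have pos: "0 < G" "0 < G'" "0 < \<alpha> * real n" using assms n0 by (auto simp: G_def G'_def intro!: Gamma_real_pos add_pos_pos)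
    have le: "(\<alpha> * real n) powr \<alpha> * G \<le> G'"
      using Gamma_ratio_ge[of "\<alpha> * real n" \<alpha>] pos assms by (simp add: G_def G'_def)
    have "0 < (\<alpha> * real n) powr \<alpha> * G" using pos by (intro mult_pos_pos) (auto simp only: powr_gt_zero)
    then have "1 / G' \<le> 1 / ((\<alpha> * real n) powr \<alpha> * G)" using le by (intro frac_le) auto
    then have G'_inv: "1 / G' \<le> (\<alpha> * real n) powr (-\<alpha>) / G"
      by (simp only: powr_minus inverse_eq_divide divide_divide_eq_left)
    have "norm (C ^ Suc n * frac_monom \<alpha> (Suc n) t) = \<bar>C\<bar> * \<bar>C\<bar> ^ n * (time_pow t \<alpha> * time_pow t (\<alpha> * real n)) * (1 / G')"
    proof -
      have e1: "\<alpha> * real (Suc n) = \<alpha> + \<alpha> * real n"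
        and e2: "\<alpha> * real (Suc n) + 1 = \<alpha> * real n + 1 + \<alpha>"
        by (simp_all add: algebra_simps)
      have "frac_monom \<alpha> (Suc n) t = time_pow t \<alpha> * time_pow t (\<alpha> * real n) / G'"
        unfolding frac_monom_def G'_def e2 unfolding e1 using assms by (simp add: time_pow_add)
      then show ?thesis using pos by (simp add: abs_mult power_abs)
    qed
    also have "\<dots> \<le> \<bar>C\<bar> * \<bar>C\<bar> ^ n * (time_pow t \<alpha> * time_pow t (\<alpha> * real n)) * ((\<alpha> * real n) powr (-\<alpha>) / G)"
      by (intro mult_left_mono G'_inv) auto
    also have "\<dots> = q n * norm (C ^ n * frac_monom \<alpha> n t)"
      using pos by (simp add: q_def frac_monom_def G_def abs_mult power_abs)
    also have "\<dots> \<le> 1/2 * norm (C ^ n * frac_monom \<alpha> n t)"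
      using N[of n] n by (intro mult_right_mono) auto
    finally show "norm (C ^ Suc n * frac_monom \<alpha> (Suc n) t) \<le> 1/2 * norm (C ^ n * frac_monom \<alpha> n t)" .
  qed simp
qed

text \<open>Fubini for series. Since each row has finite support, absolute summability over all
  pairs reduces to one series of finite sums. The argument runs through unconditional sums and is
  translated back to \<open>sums\<close> and \<open>suminf\<close>, the form in which the
  Mittag-Leffler function is given.\<close>

lemma sums_swap_finite_rows:
  fixes f :: "nat \<Rightarrow> nat \<Rightarrow> real"
  assumes fin: "\<And>n. finite (R n)" and zero: "\<And>n m. m \<notin> R n \<Longrightarrow> f n m = 0"
    and sm: "summable (\<lambda>n. \<Sum>m\<in>R n. \<bar>f n m\<bar>)"
  shows "summable (\<lambda>n. f n m)"
    and "summable (\<lambda>m. \<bar>\<Sum>n. f n m\<bar>)"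
    and "(\<lambda>m. \<Sum>n. f n m) sums (\<Sum>n. \<Sum>m\<in>R n. f n m)"
proof -
  have row: "((\<lambda>m. norm (f n m)) has_sum (\<Sum>m\<in>R n. \<bar>f n m\<bar>)) UNIV" for n
    by (rule has_sum_finite_neutralI) (use fin zero in auto)
  have row': "((\<lambda>m. f n m) has_sum (\<Sum>m\<in>R n. f n m)) UNIV" for n
    by (rule has_sum_finite_neutralI) (use fin zero in auto)
  have "(\<lambda>x. norm (case x of (n, m) \<Rightarrow> f n m)) summable_on (UNIV \<times> UNIV)"
  proof (subst Infinite_Sum.abs_summable_on_Sigma_iff, intro conjI ballI)
    fix n show "(\<lambda>m. norm (case (n, m) of (n, m) \<Rightarrow> f n m)) summable_on UNIV"
      using row[of n] by (auto simp: summable_on_def)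
    have "(\<lambda>n. \<Sum>m\<in>R n. \<bar>f n m\<bar>) summable_on UNIV"
      by (rule norm_summable_imp_summable_on) (use sm in \<open>simp add: sum_nonneg\<close>)
    then show "(\<lambda>n. norm (\<Sum>\<^sub>\<infinity>m. norm (case (n, m) of (n, m) \<Rightarrow> f n m))) summable_on UNIV"
      using infsumI[OF row] by (simp add: sum_nonneg)
  qed
  then have ab: "(\<lambda>x. norm (case x of (m, n) \<Rightarrow> f n m)) summable_on (UNIV \<times> UNIV)"
    by (subst (asm) summable_on_swap) (simp add: case_prod_unfold)
  from ab have sw: "(\<lambda>(n, m). f n m) summable_on (UNIV \<times> UNIV)"
    by (subst summable_on_swap) (use abs_summable_summable[OF ab] in \<open>simp add: case_prod_unfold\<close>)
  have col: "(\<lambda>n. norm (f n m)) summable_on UNIV" for m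
    using ab unfolding Infinite_Sum.abs_summable_on_Sigma_iff by auto
  then have colsum: "(\<lambda>n. f n m) sums (\<Sum>\<^sub>\<infinity>n. f n m)" for m
    by (rule has_sum_imp_sums[OF has_sum_infsum[OF abs_summable_summable]])
  then show "summable (\<lambda>n. f n m)" by (auto simp: sums_iff)
  have cols: "(\<Sum>n. f n m) = (\<Sum>\<^sub>\<infinity>n. f n m)" for m
    using colsum[of m] by (simp add: sums_iff)
  have abcol: "(\<lambda>m. \<Sum>\<^sub>\<infinity>n. \<bar>f n m\<bar>) summable_on UNIV"
    using ab unfolding Infinite_Sum.abs_summable_on_Sigma_iff
    by (auto simp: infsum_nonneg)
  have le: "\<bar>\<Sum>\<^sub>\<infinity>n. f n m\<bar> \<le> (\<Sum>\<^sub>\<infinity>n. \<bar>f n m\<bar>)" for m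
    using norm_infsum_bound[OF col[of m]] by simp
  have abs2: "(\<lambda>m. \<bar>\<Sum>\<^sub>\<infinity>n. f n m\<bar>) summable_on UNIV"
    by (rule summable_on_comparison_test[OF abcol]) (use le in auto)
  then show "summable (\<lambda>m. \<bar>\<Sum>n. f n m\<bar>)"
    unfolding cols by (rule summable_on_imp_summable)
  have "(\<lambda>m. \<Sum>\<^sub>\<infinity>n. f n m) sums (\<Sum>\<^sub>\<infinity>m. \<Sum>\<^sub>\<infinity>n. f n m)"
    by (rule has_sum_imp_sums[OF has_sum_infsum[OF abs_summable_summable]]) (use abs2 in simp)
  also have "(\<Sum>\<^sub>\<infinity>m. \<Sum>\<^sub>\<infinity>n. f n m) = (\<Sum>\<^sub>\<infinity>n. \<Sum>\<^sub>\<infinity>m. f n m)"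
    by (rule infsum_swap_banach[symmetric]) (use sw in simp)
  also have "\<dots> = (\<Sum>\<^sub>\<infinity>n. \<Sum>m\<in>R n. f n m)"
    using infsumI[OF row'] by simp
  also have "\<dots> = (\<Sum>n. \<Sum>m\<in>R n. f n m)"
    by (rule sums_unique[OF has_sum_imp_sums[OF has_sum_infsum[OF norm_summable_imp_summable_on]]],
        rule summable_comparison_test'[OF sm]) (auto intro: sum_abs)
  finally show "(\<lambda>m. \<Sum>n. f n m) sums (\<Sum>n. \<Sum>m\<in>R n. f n m)" by (simp add: cols)
qed

subsection \<open>Fractional integration\<close>

text \<open>The Beta integral over the unit interval under the substitution s = y + (t - y)
  x.\<close>

lemma has_bochner_integral_Beta_interval:
  fixes a b y t :: real
  assumes "0 < a" "0 < b" "y < t"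
  shows "has_bochner_integral lborel
           (\<lambda>s. indicator {y..t} s * ((s - y) powr (a - 1) * (t - s) powr (b - 1)))
           ((t - y) powr (a + b - 1) * Beta a b)"
proof -
  let ?f = "\<lambda>x. indicator {0..1} x * (x powr (a - 1) * (1 - x) powr (b - 1))"
  have "set_integrable lborel {0..1} (\<lambda>x. x powr (a - 1) * (1 - x) powr (b - 1))"
    using assms by (intro integrable_Beta)
  moreover from set_borel_integral_eq_integral(2)[OF this]
  have "(LBINT x:{0..1}. x powr (a - 1) * (1 - x) powr (b - 1)) = Beta a b"
    using has_integral_Beta_real[OF assms(1,2)] by (simp add: integral_unique)
  ultimately have "has_bochner_integral lborel ?f (Beta a b)"
    by (simp add: has_bochner_integral_iff set_integrable_def set_lebesgue_integral_def)
  then have "has_bochner_integral lborel (\<lambda>s. ?f (- y / (t - y) + 1 / (t - y) * s)) (Beta a b /\<^sub>R \<bar>1 / (t - y)\<bar>)"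
    using assms by (subst (asm) lborel_has_bochner_integral_real_affine_iff[where c = "1 / (t - y)" and t = "- y / (t - y)"]) auto
  \<comment> \<open>The exponent \<open>a + b - 2\<close> is the total degree of the integrand; the
    Jacobian contributes one further factor \<open>t - y\<close>.\<close>
  from has_bochner_integral_mult_right[OF this, of "(t - y) powr (a + b - 2)"]
  have "has_bochner_integral lborel
          (\<lambda>s. (t - y) powr (a + b - 2) * ?f (- y / (t - y) + 1 / (t - y) * s))
          ((t - y) powr (a + b - 2) * (Beta a b /\<^sub>R \<bar>1 / (t - y)\<bar>))"
    by simp
  also have "(t - y) powr (a + b - 2) * (Beta a b /\<^sub>R \<bar>1 / (t - y)\<bar>) = (t - y) powr (a + b - 1) * Beta a b"
    using assms powr_add[of "t - y" "a + b - 2" 1] by (simp add: divide_inverse)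
  also have "(\<lambda>s. (t - y) powr (a + b - 2) * ?f (- y / (t - y) + 1 / (t - y) * s)) =
             (\<lambda>s. indicator {y..t} s * ((s - y) powr (a - 1) * (t - s) powr (b - 1)))"
  proof
    fix s
    have e: "- y / (t - y) + 1 / (t - y) * s = (s - y) / (t - y)"
      by (simp add: diff_divide_distrib)
    show "(t - y) powr (a + b - 2) * ?f (- y / (t - y) + 1 / (t - y) * s) =
        indicator {y..t} s * ((s - y) powr (a - 1) * (t - s) powr (b - 1))"
    proof (cases "s \<in> {y..t}")
      case True
      have "1 - (s - y) / (t - y) = (t - s) / (t - y)" using assms by (simp add: field_simps)
      moreover have "(t - y) powr (a + b - 2) = (t - y) powr (a - 1) * (t - y) powr (b - 1)"
        by (simp add: powr_add[symmetric])
      ultimately show ?thesis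
        unfolding e using True assms by (simp add: powr_divide indicator_def field_simps)
    next
      case False
      then have "(s - y) / (t - y) \<notin> {0..1}" using assms by (auto simp: field_simps)
      then show ?thesis unfolding e using False by simp
    qed
  qed
  finally show ?thesis .
qed

text \<open>The Riemann-Liouville integral of order \<alpha>.\<close>

definition frac_integral :: "real \<Rightarrow> (real \<Rightarrow> real) \<Rightarrow> real \<Rightarrow> real" where
  "frac_integral \<alpha> f t = (LBINT s:{0..t}. (t - s) powr (\<alpha> - 1) * f s) / Gamma \<alpha>"

lemma set_integrable_frac_kernel:
  assumes "0 < \<alpha>"
  shows "set_integrable lborel {0..t} (\<lambda>s::real. (t - s) powr (\<alpha> - 1))"
proof (cases "0 < t")
  case True
  \<comment> \<open>The Beta integral with a = 1: the factor \<open>s powr 0\<close> is 1 except at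
    s = 0, where it is 0, so it agrees with the kernel almost everywhere.\<close>
  have "integrable lborel (\<lambda>s. indicator {0..t} s * ((s - 0) powr (1 - 1) * (t - s) powr (\<alpha> - 1)))"
    using has_bochner_integral_Beta_interval[of 1 \<alpha> 0 t] assms True by (simp add: has_bochner_integral_iff)
  then show ?thesis
    unfolding set_integrable_def
  proof (rule integrable_cong_AE_imp)
    show "AE s in lborel. indicator {0..t} s * ((s - 0) powr (1 - 1) * (t - s) powr (\<alpha> - 1))
            = indicator {0..t} s *\<^sub>R (t - s) powr (\<alpha> - 1)"
      using AE_lborel_singleton[of "0::real"] by eventually_elim (simp add: indicator_def)
  qed measurable
next
  case False
  then have "(\<lambda>s. indicator {0..t} s *\<^sub>R (t - s) powr (\<alpha> - 1)) = (\<lambda>_. 0)"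
    by (auto simp: indicator_def)
  then show ?thesis unfolding set_integrable_def by (metis integrable_zero)
qed

lemma set_integrable_frac_integrand:
  assumes "0 < \<alpha>" and cont: "continuous_on {0..t} f"
  shows "set_integrable lborel {0..t} (\<lambda>s::real. (t - s) powr (\<alpha> - 1) * f s :: real)"
proof -
  have "bounded (f ` {0..t})" by (intro compact_imp_bounded compact_continuous_image cont compact_Icc)
  then obtain C where C: "\<And>s. s \<in> {0..t} \<Longrightarrow> \<bar>f s\<bar> \<le> C" unfolding bounded_iff by (metis image_eqI real_norm_def)
  have m: "set_borel_measurable lborel {0..t} f"
    using borel_integrable_atLeastAtMost'[OF cont] by (auto simp: set_integrable_def set_borel_measurable_def)
  show ?thesis
  proof (rule set_integrable_bound)
    show "set_integrable lborel {0..t} (\<lambda>s. C * (t - s) powr (\<alpha> - 1))"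
      using set_integrable_frac_kernel[OF assms(1), of t] by (rule set_integrable_mult_right)
    have "(\<lambda>s. (t - s) powr (\<alpha> - 1) * (indicator {0..t} s *\<^sub>R f s)) \<in> borel_measurable lborel"
      using m unfolding set_borel_measurable_def by measurable
    then show "set_borel_measurable lborel {0..t} (\<lambda>s. (t - s) powr (\<alpha> - 1) * f s)"
      by (simp add: set_borel_measurable_def mult.left_commute)
    show "AE x in lborel. x \<in> {0..t} \<longrightarrow> norm ((t - x) powr (\<alpha> - 1) * f x) \<le> norm (C * (t - x) powr (\<alpha> - 1))"
    proof (intro AE_I2 impI)
      fix s assume "s \<in> {0..t}"
      from C[OF this] show "norm ((t - s) powr (\<alpha> - 1) * f s) \<le> norm (C * (t - s) powr (\<alpha> - 1))"
        by (auto simp: abs_mult mult.commute intro!: mult_right_mono)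
    qed
  qed
qed

lemma frac_integral_0: "frac_integral \<alpha> f 0 = 0"
  by (auto simp: frac_integral_def set_lebesgue_integral_def indicator_def intro!: integral_eq_zero_AE AE_I2)

text \<open>The Beta integral with parameters \<open>\<alpha> * n + 1\<close> and \<alpha>; its
  Gamma factors cancel both normalizations and leave the denominator for
  \<open>Suc n\<close>.\<close>

lemma frac_integral_frac_monom:
  assumes "0 < \<alpha>" "0 \<le> t"
  shows "frac_integral \<alpha> (frac_monom \<alpha> n) t = frac_monom \<alpha> (Suc n) t"
proof (cases "t = 0")
  case True
  moreover have "frac_monom \<alpha> (Suc n) 0 = 0"
    using assms by (simp add: frac_monom_def time_pow_def del: of_nat_Suc)
  ultimately show ?thesis by (simp add: frac_integral_0)
next
  case False
  define G where "G = Gamma (\<alpha> * real n + 1)"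
  have G: "G > 0" unfolding G_def using assms by (simp add: Gamma_mult_plus1_pos)
  have Ga: "Gamma \<alpha> > 0" using assms by (simp add: Gamma_real_pos)
  have hb: "has_bochner_integral lborel
          (\<lambda>s. indicator {0..t} s * ((s - 0) powr (\<alpha> * real n + 1 - 1) * (t - s) powr (\<alpha> - 1)))
          ((t - 0) powr (\<alpha> * real n + 1 + \<alpha> - 1) * Beta (\<alpha> * real n + 1) \<alpha>)"
    using assms False by (intro has_bochner_integral_Beta_interval) (auto intro: add_nonneg_pos)
  have "(LBINT s:{0..t}. (t - s) powr (\<alpha> - 1) * frac_monom \<alpha> n s) =
        (LBINT s. indicator {0..t} s * ((s - 0) powr (\<alpha> * real n + 1 - 1) * (t - s) powr (\<alpha> - 1)) / G)"
    unfolding set_lebesgue_integral_def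
  proof (rule integral_cong_AE)
    have "frac_monom \<alpha> n \<in> borel_measurable borel"
      unfolding frac_monom_def time_pow_def by measurable
    then show "(\<lambda>s. indicator {0..t} s *\<^sub>R ((t - s) powr (\<alpha> - 1) * frac_monom \<alpha> n s)) \<in> borel_measurable lborel"
      by measurable
    show "(\<lambda>s. indicator {0..t} s * ((s - 0) powr (\<alpha> * real n + 1 - 1) * (t - s) powr (\<alpha> - 1)) / G) \<in> borel_measurable lborel"
      by measurable
    \<comment> \<open>At s = 0 and n = 0, \<open>time_pow\<close> is 1 but \<open>powr\<close> is 0;
      the two sides agree only off this point.\<close>
    show "AE s in lborel. indicator {0..t} s *\<^sub>R ((t - s) powr (\<alpha> - 1) * frac_monom \<alpha> n s) =
            indicator {0..t} s * ((s - 0) powr (\<alpha> * real n + 1 - 1) * (t - s) powr (\<alpha> - 1)) / G"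
      using AE_lborel_singleton[of "0::real"]
      by eventually_elim (simp add: indicator_def frac_monom_def time_pow_def G_def)
  qed
  also have "\<dots> = t powr (\<alpha> * real n + \<alpha>) * Beta (\<alpha> * real n + 1) \<alpha> / G"
    using hb by (simp add: has_bochner_integral_iff)
  also have "\<dots> = t powr (\<alpha> * real n + \<alpha>) * Gamma \<alpha> / Gamma (\<alpha> * real n + 1 + \<alpha>)"
    using G by (simp add: Beta_def G_def)
  finally have "frac_integral \<alpha> (frac_monom \<alpha> n) t = t powr (\<alpha> * real n + \<alpha>) / Gamma (\<alpha> * real n + 1 + \<alpha>)"
    using Ga by (simp add: frac_integral_def)
  moreover have "\<alpha> * real n + \<alpha> \<noteq> 0" using assms by (simp add: add_nonneg_eq_0_iff)
  ultimately show ?thesis by (simp add: frac_monom_def time_pow_def algebra_simps)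
qed

lemma continuous_on_frac_monom:
  assumes "0 < \<alpha>"
  shows "continuous_on {0..t} (frac_monom \<alpha> n)"
proof (cases "n = 0")
  case True then show ?thesis by simp
next
  case False
  then have "\<alpha> * real n \<noteq> 0" "0 < \<alpha> * real n" using assms by auto
  then have "frac_monom \<alpha> n = (\<lambda>t. t powr (\<alpha> * real n) / Gamma (\<alpha> * real n + 1))"
    by (auto simp: frac_monom_def time_pow_def)
  moreover have "continuous_on {0..t} (\<lambda>t. t powr (\<alpha> * real n))"
    using \<open>0 < \<alpha> * real n\<close> by (intro continuous_on_powr') (auto intro: continuous_intros)
  ultimately show ?thesis using Gamma_mult_plus1_pos[of \<alpha> n] assms by (auto intro!: continuous_intros)
qed

text \<open>The kernel is nonnegative, so the operator preserves the domination, and it raises the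
  index of the dominating monomial by one.\<close>

lemma frac_integral_bound:
  assumes "0 < \<alpha>" "0 \<le> t" "continuous_on {0..t} f" "\<And>s. 0 \<le> s \<Longrightarrow> \<bar>f s\<bar> \<le> C * frac_monom \<alpha> n s"
  shows "\<bar>frac_integral \<alpha> f t\<bar> \<le> C * frac_monom \<alpha> (Suc n) t"
proof -
  have Ga: "Gamma \<alpha> > 0" using assms by (simp add: Gamma_real_pos)
  have i: "set_integrable lborel {0..t} (\<lambda>s. (t - s) powr (\<alpha> - 1) * f s)"
    using assms by (intro set_integrable_frac_integrand)
  have "\<bar>LBINT s:{0..t}. (t - s) powr (\<alpha> - 1) * f s\<bar> \<le> (LBINT s:{0..t}. \<bar>(t - s) powr (\<alpha> - 1) * f s\<bar>)"
    using set_integral_norm_bound[OF i] by simp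
  also have "\<dots> \<le> (LBINT s:{0..t}. C * ((t - s) powr (\<alpha> - 1) * frac_monom \<alpha> n s))"
  proof (rule set_integral_mono)
    show "set_integrable lborel {0..t} (\<lambda>s. \<bar>(t - s) powr (\<alpha> - 1) * f s\<bar>)"
      using set_integrable_abs[OF i] .
    show "set_integrable lborel {0..t} (\<lambda>s. C * ((t - s) powr (\<alpha> - 1) * frac_monom \<alpha> n s))"
      using assms by (intro set_integrable_mult_right set_integrable_frac_integrand continuous_on_frac_monom)
    fix s assume "s \<in> {0..t}"
    then have "\<bar>f s\<bar> \<le> C * frac_monom \<alpha> n s" using assms by auto
    from mult_left_mono[OF this, of "(t - s) powr (\<alpha> - 1)"]
    show "\<bar>(t - s) powr (\<alpha> - 1) * f s\<bar> \<le> C * ((t - s) powr (\<alpha> - 1) * frac_monom \<alpha> n s)"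
      by (simp add: abs_mult mult_ac)
  qed
  also have "\<dots> = C * (Gamma \<alpha> * frac_monom \<alpha> (Suc n) t)"
    using frac_integral_frac_monom[OF assms(1,2), of n] Ga
    by (simp add: frac_integral_def field_simps)
  finally show ?thesis using Ga
    by (simp add: frac_integral_def abs_divide pos_divide_le_eq mult_ac)
qed

lemma frac_integral_diff:
  assumes "0 < \<alpha>" "continuous_on {0..t} f" "continuous_on {0..t} g"
  shows "frac_integral \<alpha> (\<lambda>s. f s - g s) t = frac_integral \<alpha> f t - frac_integral \<alpha> g t"
  using set_integral_diff(2)[OF set_integrable_frac_integrand[OF assms(1,2)] set_integrable_frac_integrand[OF assms(1,3)]]
  by (simp add: frac_integral_def right_diff_distrib diff_divide_distrib)

lemma frac_integral_sum_frac_monom: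
  assumes "0 < \<alpha>" "0 \<le> t"
  shows "frac_integral \<alpha> (\<lambda>s. \<Sum>j<n. c j * frac_monom \<alpha> j s) t = (\<Sum>j<n. c j * frac_monom \<alpha> (Suc j) t)"
proof (induction n)
  case 0 show ?case by (simp add: frac_integral_def)
next
  case (Suc n)
  \<comment> \<open>The new summand is subtracted with coefficient \<open>- c n\<close>, so that
    additivity comes from the lemma on differences.\<close>
  have "frac_integral \<alpha> (\<lambda>s. (\<Sum>j<n. c j * frac_monom \<alpha> j s) - (- c n) * frac_monom \<alpha> n s) t
      = frac_integral \<alpha> (\<lambda>s. \<Sum>j<n. c j * frac_monom \<alpha> j s) t - frac_integral \<alpha> (\<lambda>s. (- c n) * frac_monom \<alpha> n s) t"
    using assms by (intro frac_integral_diff continuous_intros continuous_on_frac_monom)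
  moreover have "frac_integral \<alpha> (\<lambda>s. (- c n) * frac_monom \<alpha> n s) t = - c n * frac_integral \<alpha> (frac_monom \<alpha> n) t"
    using set_integral_mult_right[of lborel "{0..t}" "- c n" "\<lambda>s. (t - s) powr (\<alpha> - 1) * frac_monom \<alpha> n s"]
    by (simp add: frac_integral_def mult.left_commute)
  ultimately show ?case using Suc assms by (simp add: frac_integral_frac_monom)
qed

section \<open>From the Caputo equation to the Volterra equation\<close>

lemma frac_integral_1:
  assumes "continuous_on {0..t} g"
  shows "frac_integral 1 g t = integral {0..t} g"
proof -
  have "set_integrable lborel {0..t} (\<lambda>s. (t - s) powr (1 - 1) * g s)"
    using set_integrable_frac_integrand[of 1 t g] assms by simp
  from set_borel_integral_eq_integral(2)[OF this]
  have "frac_integral 1 g t = integral {0..t} (\<lambda>s. (t - s) powr (1 - 1) * g s)"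
    by (simp add: frac_integral_def)
  also have "\<dots> = integral {0..t} g"
    \<comment> \<open>The kernel \<open>(t - s) powr 0\<close> is 1 except at s = t.\<close>
    by (rule integral_spike[of "{t}"]) auto
  finally show ?thesis .
qed

text \<open>For \<alpha> < 1, inserting the Caputo integral for \<open>g\<close> and exchanging the
  integrations leaves the inner integral of (s - y)^(-\<alpha>) (t - s)^(\<alpha> - 1) over [y, t].
  It is \<open>Gamma (1 - \<alpha>) * Gamma \<alpha>\<close>, independent of \<open>y\<close>, so
  what remains is the integral of f'. For \<alpha> = 1 this is the fundamental theorem of
  calculus.\<close>

lemma caputo_imp_volterra:
  assumes \<alpha>: "0 < \<alpha>" "\<alpha> \<le> 1"
    and diff: "\<And>t. 0 < t \<Longrightarrow> caputo_differentiable \<alpha> f t"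
    and eq: "\<And>t. 0 < t \<Longrightarrow> caputo_deriv \<alpha> f t = g t"
    and cont: "continuous_on {0..t} g" and t: "0 \<le> t"
  shows "f t = f 0 + frac_integral \<alpha> g t"
proof (cases "t = 0 \<or> \<alpha> = 1")
  case True
  then show ?thesis
  proof
    assume "t = 0"
    then show ?thesis by (simp add: frac_integral_0)
  next
    assume a1: "\<alpha> = 1"
    have "(g has_integral (f t - f 0)) {0..t}"
    proof (cases "t = 0")
      case True
      then show ?thesis using has_integral_refl(2)[of g 0] by simp
    next
      case False
      with t have "0 < t" by simp
      then show ?thesis
      proof (intro fundamental_theorem_of_calculus_interior)
        show "continuous_on {0..t} f" using diff[OF \<open>0 < t\<close>] by (simp add: caputo_differentiable_def)
        fix x assume x: "x \<in> {0<..<t}"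
        then have "f field_differentiable at x" using diff[OF \<open>0 < t\<close>] by (simp add: caputo_differentiable_def)
        then have "(f has_field_derivative deriv f x) (at x)" by (simp add: field_differentiable_derivI)
        moreover have "deriv f x = g x" using eq[of x] x a1 by (simp add: caputo_deriv_def)
        ultimately show "(f has_vector_derivative g x) (at x)"
          by (simp add: has_real_derivative_iff_has_vector_derivative)
      qed simp
    qed
    then show ?thesis using frac_integral_1[OF cont] a1 by (simp add: integral_unique)
  qed
next
  case False
  with \<alpha> t have t: "0 < t" and \<alpha>1: "\<alpha> < 1" by auto
  \<comment> \<open>\<open>u\<close> is f' cut off to [0, t), recovered from the Caputo integrand at
    \<open>t\<close>. It inherits measurability from that integrand, and integrability because (t -
    y)^\<alpha> \<le> t^\<alpha> on [0, t].\<close>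
  define u where "u y = (t - y) powr \<alpha> * (indicator {0..t} y * ((t - y) powr (- \<alpha>) * deriv f y))" for y
  have u_eq: "u y = deriv f y" if "0 \<le> y" "y < t" for y
    using that by (simp add: u_def powr_minus)
  have u_0: "u y = 0" if "y < 0 \<or> t \<le> y" for y
    using that by (auto simp: u_def indicator_def)
  have cd: "continuous_on {0..t} f" "\<And>y. y \<in> {0<..t} \<Longrightarrow> f field_differentiable at y"
    and si: "set_integrable lborel {0..t} (\<lambda>y. (t - y) powr (- \<alpha>) * deriv f y)"
    using diff[OF t] \<alpha>1 by (auto simp: caputo_differentiable_def)
  have si': "integrable lborel (\<lambda>y. indicator {0..t} y * ((t - y) powr (- \<alpha>) * deriv f y))"
    using si by (simp add: set_integrable_def)
  have u_int: "integrable lborel u"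
  proof (rule Bochner_Integration.integrable_bound)
    show "integrable lborel (\<lambda>y. t powr \<alpha> * (indicator {0..t} y * ((t - y) powr (- \<alpha>) * deriv f y)))"
      using si' by simp
    show "u \<in> borel_measurable lborel"
      unfolding u_def using borel_measurable_integrable[OF si'] by measurable
    show "AE y in lborel. norm (u y) \<le> norm (t powr \<alpha> * (indicator {0..t} y * ((t - y) powr (- \<alpha>) * deriv f y)))"
    proof (rule AE_I2)
      fix y
      show "norm (u y) \<le> norm (t powr \<alpha> * (indicator {0..t} y * ((t - y) powr (- \<alpha>) * deriv f y)))"
      proof (cases "y \<in> {0..t}")
        case True
        then have "(t - y) powr \<alpha> \<le> t powr \<alpha>" using \<alpha> by (intro powr_mono2) auto
        then show ?thesis unfolding u_def norm_mult by (intro mult_right_mono) auto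
      qed (simp add: u_def)
    qed
  qed
  have u_meas [measurable]: "u \<in> borel_measurable lborel" using u_int by simp
  \<comment> \<open>Continuity on the closed interval and differentiability inside suffice for the
    gauge integral; since \<open>u\<close> is Lebesgue integrable, both integrals agree.\<close>
  have "(u has_integral (f t - f 0)) {0..t}"
  proof (rule fundamental_theorem_of_calculus_interior)
    fix x assume x: "x \<in> {0<..<t}"
    then have "(f has_field_derivative deriv f x) (at x)" using cd(2)[of x] by (simp add: field_differentiable_derivI)
    then show "(f has_vector_derivative u x) (at x)"
      using u_eq[of x] x by (simp add: has_real_derivative_iff_has_vector_derivative)
  qed (use t cd in auto)
  then have "(u has_integral (f t - f 0)) UNIV"
    by (rule has_integral_on_superset) (use u_0 in auto)
  with has_integral_integral_lborel[OF u_int] have u_val: "(\<integral>y. u y \<partial>lborel) = f t - f 0"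
    by (rule has_integral_unique)
  define B where "B = Gamma (1 - \<alpha>) * Gamma \<alpha>"
  have G: "0 < Gamma (1 - \<alpha>)" "0 < Gamma \<alpha>" using \<alpha> \<alpha>1 by (auto intro: Gamma_real_pos)
  \<comment> \<open>The integrand over the triangle y \<le> s \<le> t. Integrating over
    \<open>s\<close> gives a Beta integral, over \<open>y\<close> the Caputo integral at
    \<open>s\<close>.\<close>
  define F where "F = (\<lambda>(y, s). u y * (if y \<le> s \<and> s \<le> t then (s - y) powr (- \<alpha>) * (t - s) powr (\<alpha> - 1) else 0))"
  have F_row: "has_bochner_integral lborel (\<lambda>s. F (y, s)) (u y * B)"
    and F_row_norm: "has_bochner_integral lborel (\<lambda>s. norm (F (y, s))) (\<bar>u y\<bar> * B)" for y
  proof -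
    let ?k = "\<lambda>s. if y \<le> s \<and> s \<le> t then (s - y) powr (- \<alpha>) * (t - s) powr (\<alpha> - 1) else 0"
    have k: "has_bochner_integral lborel ?k B" if "y < t"
    proof -
      have "?k = (\<lambda>s. indicator {y..t} s * ((s - y) powr (1 - \<alpha> - 1) * (t - s) powr (\<alpha> - 1)))"
        by (auto simp: indicator_def)
      moreover have "(t - y) powr (1 - \<alpha> + \<alpha> - 1) * Beta (1 - \<alpha>) \<alpha> = B"
        using that by (simp add: Beta_def B_def)
      ultimately show ?thesis
        using has_bochner_integral_Beta_interval[of "1 - \<alpha>" \<alpha> y t] \<alpha> \<alpha>1 that by simp
    qed
    show "has_bochner_integral lborel (\<lambda>s. F (y, s)) (u y * B)"
    proof (cases "y < t")
      case True
      show ?thesis unfolding F_def prod.case by (rule has_bochner_integral_mult_right) (use k True in auto)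
    next
      case False
      then have "u y = 0" using u_0 by auto
      then show ?thesis by (simp add: F_def has_bochner_integral_zero)
    qed
    have n: "norm (F (y, s)) = \<bar>u y\<bar> * ?k s" for s
      by (simp add: F_def abs_mult)
    show "has_bochner_integral lborel (\<lambda>s. norm (F (y, s))) (\<bar>u y\<bar> * B)"
    proof (cases "y < t")
      case True
      show ?thesis unfolding n by (rule has_bochner_integral_mult_right) (use k True in auto)
    next
      case False
      then have "u y = 0" using u_0 by auto
      then show ?thesis by (simp add: F_def has_bochner_integral_zero)
    qed
  qed
  have F_meas: "F \<in> borel_measurable (lborel \<Otimes>\<^sub>M lborel)"
    unfolding F_def by measurable
  have F_int: "integrable (lborel \<Otimes>\<^sub>M lborel) F"
  proof (rule lborel_pair.Fubini_integrable[OF F_meas])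
    show "integrable lborel (\<lambda>y. \<integral>s. norm (F (y, s)) \<partial>lborel)"
      using F_row_norm u_int by (simp add: has_bochner_integral_iff)
    show "AE y in lborel. integrable lborel (\<lambda>s. F (y, s))"
      using F_row by (simp add: has_bochner_integral_iff)
  qed
  have "(\<integral>s. (\<integral>y. F (y, s) \<partial>lborel) \<partial>lborel) = (\<integral>y. (\<integral>s. F (y, s) \<partial>lborel) \<partial>lborel)"
    using lborel_pair.Fubini_integral[of "\<lambda>y s. F (y, s)"] F_int by simp
  also have "\<dots> = (f t - f 0) * B"
    using F_row u_val by (simp add: has_bochner_integral_iff)
  finally have lhs: "(\<integral>s. (\<integral>y. F (y, s) \<partial>lborel) \<partial>lborel) = (f t - f 0) * B" .
  \<comment> \<open>The excluded values s = 0 and s = t form a null set; for s strictly between them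
    the equation for \<open>g s\<close> is available.\<close>
  have col: "(\<integral>y. F (y, s) \<partial>lborel) = indicator {0..t} s * ((t - s) powr (\<alpha> - 1) * g s) * Gamma (1 - \<alpha>)"
    if s: "s \<noteq> 0" "s \<noteq> t" for s
  proof (cases "0 < s \<and> s < t")
    case True
    have "(\<integral>y. F (y, s) \<partial>lborel) =
        (\<integral>y. (t - s) powr (\<alpha> - 1) * (indicator {0..s} y * ((s - y) powr (- \<alpha>) * deriv f y)) \<partial>lborel)"
      by (rule Bochner_Integration.integral_cong[OF refl])
         (use True u_eq u_0 in \<open>auto simp: F_def indicator_def\<close>)
    also have "\<dots> = (t - s) powr (\<alpha> - 1) * (LBINT y:{0..s}. (s - y) powr (- \<alpha>) * deriv f y)"
      by (simp add: set_lebesgue_integral_def)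
    also have "(LBINT y:{0..s}. (s - y) powr (- \<alpha>) * deriv f y) = Gamma (1 - \<alpha>) * g s"
      using eq[of s] True \<alpha>1 G by (simp add: caputo_deriv_def field_simps)
    finally show ?thesis using True by simp
  next
    case False
    with s have "s < 0 \<or> t < s" by auto
    then have "F (y, s) = 0" for y using u_0[of y] by (auto simp: F_def)
    then show ?thesis using \<open>s < 0 \<or> t < s\<close> by auto
  qed
  have "(\<integral>s. (\<integral>y. F (y, s) \<partial>lborel) \<partial>lborel) =
        (\<integral>s. indicator {0..t} s * ((t - s) powr (\<alpha> - 1) * g s) * Gamma (1 - \<alpha>) \<partial>lborel)"
  proof (rule integral_cong_AE)
    show "(\<lambda>s. \<integral>y. F (y, s) \<partial>lborel) \<in> borel_measurable lborel"
      by (rule lborel.borel_measurable_lebesgue_integral[OF measurable_pair_swap[OF F_meas]])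
    show "(\<lambda>s. indicator {0..t} s * ((t - s) powr (\<alpha> - 1) * g s) * Gamma (1 - \<alpha>)) \<in> borel_measurable lborel"
      using borel_measurable_integrable[OF set_integrable_frac_integrand[OF \<alpha>(1) cont, unfolded set_integrable_def]]
      unfolding real_scaleR_def by (rule borel_measurable_times[OF _ borel_measurable_const])
    show "AE s in lborel. (\<integral>y. F (y, s) \<partial>lborel) = indicator {0..t} s * ((t - s) powr (\<alpha> - 1) * g s) * Gamma (1 - \<alpha>)"
      using AE_lborel_singleton[of "0::real"] AE_lborel_singleton[of t]
      by eventually_elim (rule col)
  qed
  also have "\<dots> = frac_integral \<alpha> g t * B"
    using G by (simp add: frac_integral_def B_def set_lebesgue_integral_def)
  finally have "(f t - f 0) * B = frac_integral \<alpha> g t * B" using lhs by simp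
  then show ?thesis using G by (simp add: B_def)
qed

subsection \<open>Mittag-Leffler series\<close>

text \<open>If \<open>u l\<close> comes from the l-th power of an operator H, this comes from the
  n-th power of H - a.\<close>

definition binomial_transform :: "real \<Rightarrow> (nat \<Rightarrow> real) \<Rightarrow> nat \<Rightarrow> real" where
  "binomial_transform a u n = (\<Sum>l\<le>n. real (n choose l) * (- a) ^ (n - l) * u l)"

lemma binomial_transform_0 [simp]: "binomial_transform a u 0 = u 0"
  by (simp add: binomial_transform_def)

text \<open>In operator form, (H - a)^(n+1) = - a (H - a)^n + (H - a)^n H; the proof is Pascal's
  rule and an index shift.\<close>

lemma binomial_transform_Suc:
  "binomial_transform a u (Suc n) = - a * binomial_transform a u n + binomial_transform a (\<lambda>l. u (Suc l)) n"
proof -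
  have "binomial_transform a u (Suc n) =
      (- a) ^ Suc n * u 0 + (\<Sum>l\<le>n. real (Suc n choose Suc l) * (- a) ^ (n - l) * u (Suc l))"
    unfolding binomial_transform_def by (subst sum.atMost_Suc_shift) simp
  also have "(\<Sum>l\<le>n. real (Suc n choose Suc l) * (- a) ^ (n - l) * u (Suc l)) =
      binomial_transform a (\<lambda>l. u (Suc l)) n + (\<Sum>l\<le>n. real (n choose Suc l) * (- a) ^ (n - l) * u (Suc l))"
    by (simp add: binomial_transform_def sum.distrib[symmetric] ring_distribs)
  also have "(\<Sum>l\<le>n. real (n choose Suc l) * (- a) ^ (n - l) * u (Suc l)) =
      (\<Sum>l<n. real (n choose Suc l) * (- a) ^ (n - l) * u (Suc l))"
    by (cases n) (simp_all add: lessThan_Suc_atMost binomial_eq_0)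
  also have "\<dots> = - a * (\<Sum>l<n. real (n choose Suc l) * (- a) ^ (n - Suc l) * u (Suc l))"
    unfolding sum_distrib_left
  proof (intro sum.cong refl)
    fix l assume "l \<in> {..<n}"
    then have "n - l = Suc (n - Suc l)" by auto
    then show "real (n choose Suc l) * (- a) ^ (n - l) * u (Suc l) =
        - a * (real (n choose Suc l) * (- a) ^ (n - Suc l) * u (Suc l))" by simp
  qed
  finally have "binomial_transform a u (Suc n) = binomial_transform a (\<lambda>l. u (Suc l)) n
      - a * ((- a) ^ n * u 0 + (\<Sum>l<n. real (n choose Suc l) * (- a) ^ (n - Suc l) * u (Suc l)))"
    by (simp add: algebra_simps)
  also have "(- a) ^ n * u 0 + (\<Sum>l<n. real (n choose Suc l) * (- a) ^ (n - Suc l) * u (Suc l)) = binomial_transform a u n"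
    unfolding binomial_transform_def
    by (cases n) (simp_all add: sum.atMost_Suc_shift lessThan_Suc_atMost del: sum.atMost_Suc)
  finally show ?thesis by simp
qed

lemma binomial_transform_linear:
  "binomial_transform a (\<lambda>l. x * u l + y * v l) n = x * binomial_transform a u n + y * binomial_transform a v n"
  by (simp add: binomial_transform_def sum.distrib sum_distrib_left algebra_simps)

lemma binomial_transform_power: "binomial_transform a (\<lambda>l. a ^ l) n = (if n = 0 then 1 else 0)"
  using binomial_ring[of a "- a" n]
  by (simp add: binomial_transform_def mult_ac power_0_left)

text \<open>
  With \<open>x\<close> standing for the fractional integration operator and \<open>z = x / (1 + a x)\<close>, this function
  corresponds to \<open>z\<^sup>l (1 - a z)\<close>, hence \<open>(\<Sum>l. a\<^sup>l F l) = 1\<close>.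
\<close>

definition ml_term :: "real \<Rightarrow> real \<Rightarrow> real \<Rightarrow> nat \<Rightarrow> real" where
  "ml_term \<alpha> a t l =
     time_pow t (\<alpha> * real l) * mittag_leffler \<alpha> (\<alpha> * real l + 1) (real l + 1) (- a * time_pow t \<alpha>)"

lemma pochhammer_Suc_div_fact: "pochhammer (real l + 1) j / fact j = real ((l + j) choose l)"
proof -
  have "real ((l + j) choose l) = real ((l + j) choose j)"
    using binomial_symmetric[of l "l + j"] by simp
  also have "\<dots> = pochhammer (real l + 1) j / fact j"
    by (simp add: binomial_gbinomial gbinomial_pochhammer')
  finally show ?thesis by simp
qed

text \<open>Expanding the Mittag-Leffler series, \<open>ml_term\<close> at \<open>l\<close> is the
  sum over n \<ge> l of \<open>(n choose l) * (- a) ^ (n - l) * frac_monom \<alpha> n t\<close>.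
  Exchanging the sums collects the binomial transform of \<open>u\<close> as coefficient of each
  monomial. The geometric bound on \<open>u\<close> turns into \<open>K * (H + a) ^ n\<close> by the
  binomial theorem, which gives absolute convergence.\<close>

lemma ml_term_sums:
  fixes u :: "nat \<Rightarrow> real"
  assumes "0 < \<alpha>" "0 \<le> a" "0 \<le> t" "0 \<le> H" and u: "\<And>l. \<bar>u l\<bar> \<le> K * H ^ l"
  shows "summable (\<lambda>l. \<bar>u l * ml_term \<alpha> a t l\<bar>)"
    and "(\<lambda>l. u l * ml_term \<alpha> a t l) sums (\<Sum>n. binomial_transform a u n * frac_monom \<alpha> n t)"
proof -
  have row_summable: "summable (\<lambda>n. \<Sum>l\<le>n. \<bar>v l\<bar> * (real (n choose l) * a ^ (n - l)) * frac_monom \<alpha> n t)"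
    if v: "\<And>l. \<bar>v l\<bar> \<le> K * H ^ l" for v and K :: real
  proof (rule summable_comparison_test')
    show "summable (\<lambda>n. K * ((H + a) ^ n * frac_monom \<alpha> n t))"
      using summable_frac_monom[of \<alpha> t "H + a"] assms by (intro summable_mult)
    fix n
    have "(\<Sum>l\<le>n. \<bar>v l\<bar> * (real (n choose l) * a ^ (n - l)) * frac_monom \<alpha> n t)
       \<le> (\<Sum>l\<le>n. K * H ^ l * (real (n choose l) * a ^ (n - l)) * frac_monom \<alpha> n t)"
      using assms v by (intro sum_mono mult_right_mono) auto
    also have "\<dots> = K * ((H + a) ^ n * frac_monom \<alpha> n t)"
      by (simp add: binomial_ring sum_distrib_left sum_distrib_right mult_ac)
    moreover have "0 \<le> (\<Sum>l\<le>n. \<bar>v l\<bar> * (real (n choose l) * a ^ (n - l)) * frac_monom \<alpha> n t)"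
      using assms by (intro sum_nonneg) auto
    ultimately show "norm (\<Sum>l\<le>n. \<bar>v l\<bar> * (real (n choose l) * a ^ (n - l)) * frac_monom \<alpha> n t)
       \<le> K * ((H + a) ^ n * frac_monom \<alpha> n t)" by simp
  qed
  define f where "f v n l = (if l \<le> n then v l * (real (n choose l) * (- a) ^ (n - l)) * frac_monom \<alpha> n t else 0)"
    for v n l
  have f_abs: "(\<Sum>l\<le>n. \<bar>f v n l\<bar>) = (\<Sum>l\<le>n. \<bar>v l\<bar> * (real (n choose l) * a ^ (n - l)) * frac_monom \<alpha> n t)" for v n
    using assms by (intro sum.cong refl) (simp add: f_def abs_mult power_abs)
  have swap: "summable (\<lambda>n. f v n l)" "summable (\<lambda>l. \<bar>\<Sum>n. f v n l\<bar>)"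
       "(\<lambda>l. \<Sum>n. f v n l) sums (\<Sum>n. \<Sum>l\<le>n. f v n l)"
    if "\<And>l. \<bar>v l\<bar> \<le> K * H ^ l" for v l and K :: real
    using sums_swap_finite_rows[of "\<lambda>n. {..n}" "f v"] row_summable[OF that] by (auto simp: f_abs) (auto simp: f_def)
  have ml: "(\<Sum>n. f u n l) = u l * ml_term \<alpha> a t l" for l
  proof -
    define c where "c = u l * time_pow t (\<alpha> * real l)"
    define g where "g j = pochhammer (real l + 1) j * (- a * time_pow t \<alpha>) ^ j / (fact j * Gamma (\<alpha> * real j + (\<alpha> * real l + 1)))"
      for j
    have sm: "summable (\<lambda>n. f u n l)" by (rule swap(1)[OF u])
    \<comment> \<open>The substitution n = j + l identifies column \<open>l\<close> with the
      Mittag-Leffler series.\<close>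
    have "f u (j + l) l = c * g j" for j
    proof -
      have e1: "time_pow t (\<alpha> * real (j + l)) = time_pow t (\<alpha> * real l) * time_pow t \<alpha> ^ j"
        using assms by (simp add: time_pow_power time_pow_add[symmetric] algebra_simps)
      have e2: "\<alpha> * real (j + l) + 1 = \<alpha> * real j + (\<alpha> * real l + 1)" by (simp add: algebra_simps)
      have e3: "(- a * time_pow t \<alpha>) ^ j = (- a) ^ j * time_pow t \<alpha> ^ j" by (rule power_mult_distrib)
      have e4: "pochhammer (real l + 1) j = fact j * real ((l + j) choose l)"
        using pochhammer_Suc_div_fact[of l j] by (simp add: divide_eq_eq mult.commute)
      show ?thesis
        unfolding f_def c_def g_def frac_monom_def e1 e2 e3 e4 by (simp add: add.commute[of j l])
    qed
    then have sh: "(\<lambda>j. f u (j + l) l) = (\<lambda>j. c * g j)" by simp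
    have "(\<Sum>n. f u n l) = (\<Sum>j. f u (j + l) l)"
      using suminf_minus_initial_segment[OF sm, of l] by (simp add: f_def)
    also have "\<dots> = c * (\<Sum>j. g j)"
    \<comment> \<open>Summability of \<open>g\<close> is read off from that of \<open>c * g\<close>,
      which requires a nonzero \<open>c\<close>; for c = 0 both sides vanish.\<close>
    proof (cases "c = 0")
      case False
      moreover have "summable (\<lambda>j. c * g j)" using summable_ignore_initial_segment[OF sm, of l] unfolding sh .
      ultimately have "summable g" by (simp add: summable_cmult_iff)
      then show ?thesis unfolding sh by (rule suminf_mult)
    qed (simp add: sh)
    also have "\<dots> = u l * ml_term \<alpha> a t l"
      by (simp add: c_def g_def[abs_def] ml_term_def mittag_leffler_def)
    finally show ?thesis .
  qed
  have rows: "(\<Sum>l\<le>n. f u n l) = binomial_transform a u n * frac_monom \<alpha> n t" for n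
    by (simp add: f_def binomial_transform_def sum_distrib_left sum_distrib_right mult_ac)
  show "summable (\<lambda>l. \<bar>u l * ml_term \<alpha> a t l\<bar>)"
    using swap(2)[OF u] by (simp add: ml)
  show "(\<lambda>l. u l * ml_term \<alpha> a t l) sums (\<Sum>n. binomial_transform a u n * frac_monom \<alpha> n t)"
    using swap(3)[OF u] by (simp add: ml rows)
qed

text \<open>The binomial transform of the powers of \<open>a\<close> is (a - a)^n, so only the
  constant monomial survives.\<close>

lemma ml_term_sums_one:
  assumes "0 < \<alpha>" "0 \<le> a" "0 \<le> t"
  shows "(\<lambda>l. a ^ l * ml_term \<alpha> a t l) sums 1"
proof -
  have "(\<lambda>l. a ^ l * ml_term \<alpha> a t l) sums (\<Sum>n. binomial_transform a (\<lambda>l. a ^ l) n * frac_monom \<alpha> n t)"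
    using assms by (intro ml_term_sums(2)[where H = a and K = 1]) auto
  also have "(\<Sum>n. binomial_transform a (\<lambda>l. a ^ l) n * frac_monom \<alpha> n t) = 1"
    using suminf_finite[of "{0}" "\<lambda>n. binomial_transform a (\<lambda>l. a ^ l) n * frac_monom \<alpha> n t"]
    by (simp add: binomial_transform_power)
  finally show ?thesis .
qed

text \<open>Passes between the outer index \<open>r\<close> of the stated double sums and the index
  \<open>l\<close> of the function \<open>ml_term\<close>. \<open>R l\<close> and \<open>L r\<close>
  are finite supports of the rows and columns of the coefficient array.\<close>

lemma ml_term_rearranged:
  fixes c :: "nat \<Rightarrow> nat \<Rightarrow> real"
  assumes "0 < \<alpha>" "0 \<le> a" "0 \<le> t" "0 \<le> H"
    and fin: "\<And>l. finite (R l)" and zero: "\<And>l r. r \<notin> R l \<Longrightarrow> c l r = 0"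
    and bound: "\<And>l. (\<Sum>r\<in>R l. \<bar>c l r\<bar>) \<le> K * H ^ l"
    and L: "\<And>r. finite (L r)" "\<And>l r. l \<notin> L r \<Longrightarrow> c l r = 0"
  shows "(\<lambda>r. \<Sum>l\<in>L r. c l r * ml_term \<alpha> a t l) sums
           (\<Sum>l. (\<Sum>r\<in>R l. c l r) * ml_term \<alpha> a t l)"
proof -
  have "(\<lambda>r. \<Sum>l. c l r * ml_term \<alpha> a t l) sums (\<Sum>l. \<Sum>r\<in>R l. c l r * ml_term \<alpha> a t l)"
  proof (rule sums_swap_finite_rows(3)[OF fin])
    show "c l r * ml_term \<alpha> a t l = 0" if "r \<notin> R l" for l r using zero[OF that] by simp
    have "summable (\<lambda>l. \<bar>(\<Sum>r\<in>R l. \<bar>c l r\<bar>) * ml_term \<alpha> a t l\<bar>)"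
      using bound assms by (intro ml_term_sums(1)[where K = K and H = H]) (auto simp: sum_nonneg)
    then show "summable (\<lambda>l. \<Sum>r\<in>R l. \<bar>c l r * ml_term \<alpha> a t l\<bar>)"
      by (simp add: abs_mult sum_nonneg flip: sum_distrib_right)
  qed
  moreover have "(\<Sum>l. c l r * ml_term \<alpha> a t l) = (\<Sum>l\<in>L r. c l r * ml_term \<alpha> a t l)" for r
    using L by (intro suminf_finite) auto
  ultimately show ?thesis by (simp add: sum_distrib_right)
qed

subsection \<open>State probabilities\<close>

definition mm1_generator :: "real \<Rightarrow> real \<Rightarrow> (nat \<Rightarrow> real) \<Rightarrow> nat \<Rightarrow> real" where
  "mm1_generator lam mu u k =
     (if k = 0 then - lam * u 0 + mu * u 1 else - (lam + mu) * u k + lam * u (k - 1) + mu * u (k + 1))"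

lemma mm1_generator_diff_sum:
  fixes n :: nat
  shows "mm1_generator lam mu (\<lambda>k. u k - (\<Sum>j<n. c j k * x j)) k =
     mm1_generator lam mu u k - (\<Sum>j<n. mm1_generator lam mu (c j) k * x j)"
  by (induction n) (auto simp: mm1_generator_def algebra_simps)

lemma mm1_generator_bound:
  assumes "0 < lam" "0 < mu" and u: "\<And>k. \<bar>u k\<bar> \<le> C"
  shows "\<bar>mm1_generator lam mu u k\<bar> \<le> 2 * (lam + mu) * C"
proof -
  have b: "\<bar>x * u j\<bar> \<le> \<bar>x\<bar> * C" for x j
    unfolding abs_mult by (intro mult_left_mono u) auto
  have C: "0 \<le> C" using u[of 0] by linarith
  show ?thesis
  proof (cases "k = 0")
    case True
    have "0 \<le> lam * C" "0 \<le> mu * C" using assms C by auto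
    then show ?thesis using True b[of lam 0] b[of mu 1] assms
      by (simp add: mm1_generator_def algebra_simps)
  next
    case False
    then show ?thesis using b[of "lam + mu" k] b[of lam "k - 1"] b[of mu "k + 1"] assms
      by (simp add: mm1_generator_def algebra_simps)
  qed
qed

text \<open>The remainder after \<open>n\<close> terms is the fractional integral of the generator
  applied to the previous remainder. Induction over all \<open>k\<close> and \<open>t\<close> at
  once bounds it by \<open>a ^ n * frac_monom \<alpha> n t\<close>, starting from the bound 1 on
  \<open>p\<close>.\<close>

lemma volterra_solution_sums:
  fixes p :: "nat \<Rightarrow> real \<Rightarrow> real" and c :: "nat \<Rightarrow> nat \<Rightarrow> real"
  assumes "0 < \<alpha>" "0 < lam" "0 < mu"
    and bound: "\<And>k t. 0 \<le> t \<Longrightarrow> \<bar>p k t\<bar> \<le> 1"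
    and cont: "\<And>k t. continuous_on {0..t} (p k)"
    and volterra: "\<And>k t. 0 \<le> t \<Longrightarrow>
       p k t = c 0 k + frac_integral \<alpha> (\<lambda>s. mm1_generator lam mu (\<lambda>k. p k s) k) t"
    and c_Suc: "\<And>n k. c (Suc n) k = mm1_generator lam mu (c n) k"
    and "0 \<le> t"
  shows "(\<lambda>n. c n k * frac_monom \<alpha> n t) sums p k t"
proof -
  define a where "a = 2 * (lam + mu)"
  have cont_gen: "continuous_on {0..t} (\<lambda>s. mm1_generator lam mu (\<lambda>k. p k s) k)" for k t
    unfolding mm1_generator_def by (cases "k = 0") (auto intro!: continuous_intros cont)
  have est: "\<bar>p k t - (\<Sum>j<n. c j k * frac_monom \<alpha> j t)\<bar> \<le> a ^ n * frac_monom \<alpha> n t"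
    if "0 \<le> t" for n k t
    using that
  proof (induction n arbitrary: k t)
    case 0
    then show ?case using bound by simp
  next
    case (Suc n)
    define e where "e s k = p k s - (\<Sum>j<n. c j k * frac_monom \<alpha> j s)" for s k
    have cont_poly: "continuous_on {0..t} (\<lambda>s. \<Sum>j<n. c (Suc j) k * frac_monom \<alpha> j s)"
      using assms(1) by (intro continuous_intros continuous_on_frac_monom)
    have gen_e: "mm1_generator lam mu (e s) k =
        mm1_generator lam mu (\<lambda>k. p k s) k - (\<Sum>j<n. c (Suc j) k * frac_monom \<alpha> j s)" for s
      unfolding e_def c_Suc by (rule mm1_generator_diff_sum)
    have "(\<Sum>j<Suc n. c j k * frac_monom \<alpha> j t) = c 0 k + (\<Sum>j<n. c (Suc j) k * frac_monom \<alpha> (Suc j) t)"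
      by (simp only: sum.lessThan_Suc_shift frac_monom_0 mult_1_right)
    then have "p k t - (\<Sum>j<Suc n. c j k * frac_monom \<alpha> j t) =
        frac_integral \<alpha> (\<lambda>s. mm1_generator lam mu (\<lambda>k. p k s) k) t
        - frac_integral \<alpha> (\<lambda>s. \<Sum>j<n. c (Suc j) k * frac_monom \<alpha> j s) t"
      using volterra[OF Suc.prems, of k] frac_integral_sum_frac_monom[OF assms(1) Suc.prems] by simp
    also have "\<dots> = frac_integral \<alpha> (\<lambda>s. mm1_generator lam mu (e s) k) t"
      unfolding gen_e by (rule frac_integral_diff[OF assms(1) cont_gen cont_poly, symmetric])
    also have "\<bar>\<dots>\<bar> \<le> a ^ Suc n * frac_monom \<alpha> (Suc n) t"
    proof (rule frac_integral_bound[OF assms(1) Suc.prems])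
      show "continuous_on {0..t} (\<lambda>s. mm1_generator lam mu (e s) k)"
        unfolding gen_e by (intro continuous_on_diff cont_gen cont_poly)
      fix s :: real assume "0 \<le> s"
      then have "\<bar>e s j\<bar> \<le> a ^ n * frac_monom \<alpha> n s" for j
        unfolding e_def by (rule Suc.IH)
      from mm1_generator_bound[of lam mu "e s" "a ^ n * frac_monom \<alpha> n s" k, OF assms(2,3) this]
      show "\<bar>mm1_generator lam mu (e s) k\<bar> \<le> a ^ Suc n * frac_monom \<alpha> n s"
        by (simp add: a_def mult.assoc)
    qed
    finally show ?case .
  qed
  \<comment> \<open>The bounds on the remainder are the terms of a convergent series.\<close>
  have "(\<lambda>n. a ^ n * frac_monom \<alpha> n t) \<longlonglongrightarrow> 0"
    using assms by (intro summable_LIMSEQ_zero summable_frac_monom)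
  then have "(\<lambda>n. p k t - (\<Sum>j<n. c j k * frac_monom \<alpha> j t)) \<longlonglongrightarrow> 0"
    by (rule Lim_null_comparison[rotated]) (use est[OF \<open>0 \<le> t\<close>] in auto)
  from tendsto_diff[OF tendsto_const[of "p k t"] this]
  show ?thesis by (simp add: sums_def)
qed

section \<open>Path counts as coefficients of the state probabilities\<close>

lemma binomial_transform_queue_paths_0:
  "binomial_transform a (\<lambda>l. queue_paths lam mu i l (int k)) 0 = (if k = i then 1 else 0)"
  by (simp add: queue_paths_0)

text \<open>For k > 0 the recurrence of the path counts is the generator plus
  \<open>lam + mu\<close>. At k = 0 the boundary relation replaces the inflow from -1 by
  \<open>mu\<close> times the value at 0, which reduces the outflow rate to
  \<open>lam\<close>.\<close>

lemma binomial_transform_queue_paths_Suc: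
  assumes "0 < lam" "0 < mu"
  shows "binomial_transform (lam + mu) (\<lambda>l. queue_paths lam mu i l (int k)) (Suc n) =
     mm1_generator lam mu (\<lambda>k. binomial_transform (lam + mu) (\<lambda>l. queue_paths lam mu i l (int k)) n) k"
proof -
  have nz: "lam \<noteq> 0" "mu \<noteq> 0" using assms by auto
  show ?thesis
  proof (cases k)
    case 0
    have "queue_paths lam mu i (Suc l) 0 = mu * queue_paths lam mu i l 0 + mu * queue_paths lam mu i l 1" for l
      using queue_paths_Suc[OF nz, of i l 0] queue_paths_boundary[OF nz, of i l] by simp
    then show ?thesis using 0
      by (simp add: binomial_transform_Suc binomial_transform_linear mm1_generator_def algebra_simps)
  next
    case (Suc j)
    have "queue_paths lam mu i (Suc l) (int k) =
        lam * queue_paths lam mu i l (int (k - 1)) + mu * queue_paths lam mu i l (int (k + 1))" for l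
      using queue_paths_Suc[OF nz, of i l "int k"] Suc by (simp add: algebra_simps)
    then have "binomial_transform (lam + mu) (\<lambda>l. queue_paths lam mu i (Suc l) (int k)) n =
       lam * binomial_transform (lam + mu) (\<lambda>l. queue_paths lam mu i l (int (k - 1))) n
       + mu * binomial_transform (lam + mu) (\<lambda>l. queue_paths lam mu i l (int (k + 1))) n"
      by (simp only: binomial_transform_linear)
    then show ?thesis using Suc
      by (simp add: binomial_transform_Suc mm1_generator_def)
  qed
qed

text \<open>Conditional probabilities supply the bound 1 and Caputo differentiability the
  continuity, so the iterated Volterra equation applies with the transformed path counts as
  coefficients.\<close>

lemma state_prob_sums:
  assumes "0 < \<alpha>" "\<alpha> \<le> 1" "0 < lam" "0 < mu"
    and queue: "fractional_MM1_queue M N \<alpha> lam mu i" and "0 \<le> t"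
  shows "(\<lambda>n. binomial_transform (lam + mu) (\<lambda>l. queue_paths lam mu i l (int k)) n * frac_monom \<alpha> n t)
           sums state_prob M N i k t"
proof -
  define p where "p = state_prob M N i"
  interpret prob_space M using queue by (simp add: fractional_MM1_queue_def)
  have diff: "\<And>k t. 0 < t \<Longrightarrow> caputo_differentiable \<alpha> (p k) t"
    and eq: "\<And>k t. 0 < t \<Longrightarrow> caputo_deriv \<alpha> (p k) t = mm1_generator lam mu (\<lambda>k. p k t) k"
    and init: "\<And>k. p k 0 = (if k = i then 1 else 0)"
    and meas: "\<And>t. 0 \<le> t \<Longrightarrow> N t \<in> measurable M (count_space UNIV)"
    using queue by (auto simp: fractional_MM1_queue_def Let_def p_def mm1_generator_def)
  have cont: "continuous_on {0..t} (p k)" for k t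
    using diff[of t k] by (cases "0 < t"; cases "t = 0") (auto simp: caputo_differentiable_def)
  have bound: "\<bar>p k t\<bar> \<le> 1" if "0 \<le> t" for k t
  proof -
    have [measurable]: "N t \<in> measurable M (count_space UNIV)" "N 0 \<in> measurable M (count_space UNIV)"
      using meas that by auto
    have "prob {\<omega> \<in> space M. N t \<omega> = k \<and> N 0 \<omega> = i} \<le> prob {\<omega> \<in> space M. N 0 \<omega> = i}"
      by (intro finite_measure_mono) auto
    then show ?thesis
      by (auto simp: p_def state_prob_def cond_prob_def divide_le_eq_1 zero_less_measure_iff)
  qed
  show ?thesis
    unfolding p_def[symmetric]
  proof (rule volterra_solution_sums[OF assms(1,3,4) bound cont])
    fix k t assume "0 \<le> (t :: real)"
    have "continuous_on {0..t} (\<lambda>s. mm1_generator lam mu (\<lambda>k. p k s) k)"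
      unfolding mm1_generator_def by (cases "k = 0") (auto intro!: continuous_intros cont)
    then show "p k t = binomial_transform (lam + mu) (\<lambda>l. queue_paths lam mu i l (int k)) 0
         + frac_integral \<alpha> (\<lambda>s. mm1_generator lam mu (\<lambda>k. p k s) k) t"
      using caputo_imp_volterra[OF assms(1,2) diff eq _ \<open>0 \<le> t\<close>]
      unfolding binomial_transform_queue_paths_0 init[of k, symmetric] by blast
  next
    fix n k
    show "binomial_transform (lam + mu) (\<lambda>l. queue_paths lam mu i l (int k)) (Suc n) =
      mm1_generator lam mu (\<lambda>k. binomial_transform (lam + mu) (\<lambda>l. queue_paths lam mu i l (int k)) n) k"
      by (rule binomial_transform_queue_paths_Suc[OF assms(3,4)])
  qed (use assms in auto)
qed

section \<open>Coefficients of the two double sums\<close>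

lemma ballot_eq:
  assumes "r \<le> Suc l"
  shows "(real r - real (Suc l - r)) / (real r + real (Suc l - r)) * real (Suc l choose r) = - ballot l (int r)"
proof -
  \<comment> \<open>Absorption: r C(l+1, r) = (l+1) C(l, r-1), and its companion (l+1-r) C(l+1, r) =
    (l+1) C(l, r). Their difference expresses the ballot number through C(l+1, r).\<close>
  have "int_choose l (int r - 1) * real (Suc l) = real r * real (Suc l choose r)"
  proof (cases r)
    case (Suc q)
    then have "int_choose l (int r - 1) = real (l choose q)" by (simp add: int_choose_def)
    then show ?thesis using Suc_times_binomial[of q l] Suc by (metis mult.commute of_nat_mult)
  qed simp
  moreover have "int_choose l (int r) * real (Suc l) = (real (Suc l) - real r) * real (Suc l choose r)"
    using calculation int_choose_Suc[of l "int r"] by (simp add: algebra_simps del: binomial_Suc_Suc)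
  ultimately have "ballot l (int r) * real (Suc l) = (real (Suc l) - 2 * real r) * real (Suc l choose r)"
    unfolding ballot_def by (simp only: left_diff_distrib)
  moreover have L: "real (Suc l) \<noteq> 0" by simp
  ultimately have b: "ballot l (int r) = (real (Suc l) - 2 * real r) * real (Suc l choose r) / real (Suc l)"
    by (simp only: nonzero_eq_divide_eq[OF L])
  have d: "real r + real (Suc l - r) = real (Suc l)" "real r - real (Suc l - r) = 2 * real r - real (Suc l)"
    using assms by (auto simp: of_nat_diff)
  show ?thesis
    unfolding b d by (simp only: minus_divide_left minus_mult_left minus_diff_eq times_divide_eq_left)
qed

text \<open>The cutoff admits every r \<le> l + 1, also after it is lowered in the recurrence, so
  each step multiplies by \<open>lam + mu\<close>. At l = 0 the summands r = 0 and r = 1 give 1 and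
  \<open>- lam / mu\<close>.\<close>

lemma ballot_sum_total:
  assumes "mu \<noteq> 0" "2 * int (Suc l) \<le> b"
  shows "ballot_sum lam mu l b = (1 - lam / mu) * (lam + mu) ^ l"
  using assms(2)
proof (induction l arbitrary: b)
  case 0
  then show ?case by (simp add: ballot_sum_def ballot_def int_choose_def power_int_minus divide_inverse)
next
  case (Suc l)
  then have "ballot_sum lam mu l b = (1 - lam / mu) * (lam + mu) ^ l"
    "ballot_sum lam mu l (b - 2) = (1 - lam / mu) * (lam + mu) ^ l" by auto
  then show ?case by (simp add: ballot_sum_Suc[OF assms(1)] ring_distribs mult_ac)
qed

text \<open>The summand of the first double sum at \<open>m = l + 1 - r\<close>.\<close>

definition ballot_coeff :: "real \<Rightarrow> real \<Rightarrow> nat \<Rightarrow> nat \<Rightarrow> nat \<Rightarrow> nat \<Rightarrow> real" where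
  "ballot_coeff lam mu i k l r =
     (if r \<le> Suc l \<and> Suc l \<le> k + 2 * r + i
      then (real r - real (Suc l - r)) / (real r + real (Suc l - r)) * real (Suc l choose r)
             * lam ^ r * mu powi (int (Suc l - r) - 1)
      else 0)"

text \<open>Each \<open>r\<close> meets a single \<open>l\<close>, namely k + 2 r - i; as a
  two-index array the single sum falls under the same rearrangement as the double sum.\<close>

definition reflection_coeff :: "real \<Rightarrow> real \<Rightarrow> nat \<Rightarrow> nat \<Rightarrow> nat \<Rightarrow> nat \<Rightarrow> real" where
  "reflection_coeff lam mu i k l r =
     (if int l = int k + 2 * int r - int i
      then (real (l choose r) - real (l choose (k + r))) * lam powi (int l - int r) * mu ^ r
      else 0)"

text \<open>The restriction m \<le> k + r + i selects the \<open>r\<close> with 2 r > l - k - i,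
  complementary to those in the truncated sum. As \<open>ballot_eq\<close> brings a minus sign, the
  result is the truncated sum minus the total.\<close>

lemma sum_ballot_coeff:
  assumes "mu \<noteq> 0"
  shows "(\<Sum>r\<le>Suc l. ballot_coeff lam mu i k l r) =
           ballot_sum lam mu l (int l - int k - int i) - (1 - lam / mu) * (lam + mu) ^ l"
proof -
  have "(\<Sum>r\<le>Suc l. ballot_coeff lam mu i k l r) =
      ballot_sum lam mu l (int l - int k - int i) - ballot_sum lam mu l (2 * int (Suc l))"
    unfolding ballot_sum_def sum_subtractf[symmetric]
  proof (intro sum.cong refl)
    fix r assume r: "r \<in> {..Suc l}"
    then have "int (Suc l - r) - 1 = int l - int r" by auto
    then show "ballot_coeff lam mu i k l r =
        (if 2 * int r \<le> int l - int k - int i then ballot l (int r) * lam ^ r * mu powi (int l - int r) else 0) -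
        (if 2 * int r \<le> 2 * int (Suc l) then ballot l (int r) * lam ^ r * mu powi (int l - int r) else 0)"
      unfolding ballot_coeff_def using r by (subst ballot_eq) auto
  qed
  then show ?thesis using ballot_sum_total[OF assms, of l "2 * int (Suc l)"] by simp
qed

lemma sum_reflection_coeff:
  "(\<Sum>r\<le>l + i. reflection_coeff lam mu i k l r) = reflected_paths lam mu i l (int k)"
proof (cases "even (int l + int i - int k)")
  case True
  then obtain d where d: "int l + int i - int k = 2 * d" by (elim evenE)
  have rp: "reflected_paths lam mu i l (int k) =
      (int_choose l d - int_choose l (int k + d)) * lam powi (int l - d) * mu powi d"
    by (simp add: reflected_paths_def d Let_def)
  show ?thesis
  proof (cases "d < 0")
    case True
    then have "reflection_coeff lam mu i k l r = 0" for r using d by (auto simp: reflection_coeff_def)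
    \<comment> \<open>Here l - (k + d) = d - i < 0, so the mirror binomial vanishes together with
      the first one.\<close>
    moreover have "int l < int k + d" using True d by auto
    ultimately show ?thesis using True by (simp add: rp)
  next
    case False
    then obtain q where q: "d = int q" by (metis nat_0_le not_less)
    have "reflection_coeff lam mu i k l r = (if r = q then reflected_paths lam mu i l (int k) else 0)" for r
      using d q by (auto simp: reflection_coeff_def rp simp flip: of_nat_add)
    moreover have "q \<le> l + i" using d q by auto
    ultimately show ?thesis by simp
  qed
next
  case False
  have "reflection_coeff lam mu i k l r = 0" for r
  proof -
    have "int l \<noteq> int k + 2 * int r - int i"
    proof
      assume "int l = int k + 2 * int r - int i"
      then have "int l + int i - int k = 2 * int r" by simp
      then show False using False by simp
    qed
    then show ?thesis by (simp add: reflection_coeff_def)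
  qed
  then show ?thesis using False by (simp add: reflected_paths_def)
qed

text \<open>The first summand restores the total that is subtracted in
  \<open>sum_ballot_coeff\<close>; it becomes the constant term of the theorem.\<close>

lemma queue_paths_eq_sum_coeffs:
  assumes "mu \<noteq> 0"
  shows "queue_paths lam mu i l (int k) =
     (1 - lam / mu) * (lam / mu) ^ k * (lam + mu) ^ l
     + (lam / mu) ^ k * (\<Sum>r\<le>Suc l. ballot_coeff lam mu i k l r)
     + (\<Sum>r\<le>l + i. reflection_coeff lam mu i k l r)"
  unfolding queue_paths_def sum_ballot_coeff[OF assms] sum_reflection_coeff
  by (simp add: algebra_simps)

text \<open>The quotient of r - m and r + m is at most 1 in absolute value; the binomial theorem
  sums the rest.\<close>

lemma sum_abs_ballot_coeff_le:
  assumes "0 < lam" "0 < mu"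
  shows "(\<Sum>r\<le>Suc l. \<bar>ballot_coeff lam mu i k l r\<bar>) \<le> (lam + mu) / mu * (lam + mu) ^ l"
proof -
  have "(\<Sum>r\<le>Suc l. \<bar>ballot_coeff lam mu i k l r\<bar>) \<le>
        (\<Sum>r\<le>Suc l. real (Suc l choose r) * lam ^ r * mu ^ (Suc l - r) / mu)"
  proof (intro sum_mono)
    fix r assume r: "r \<in> {..Suc l}"
    have q: "\<bar>(real r - real (Suc l - r)) / (real r + real (Suc l - r))\<bar> \<le> 1"
      by (simp add: abs_divide divide_le_eq_1) arith
    have p: "mu powi (int (Suc l - r) - 1) = mu ^ (Suc l - r) / mu"
      using assms power_int_diff[of mu "int (Suc l - r)" 1] by simp
    have "\<bar>(real r - real (Suc l - r)) / (real r + real (Suc l - r))\<bar> * (real (Suc l choose r) * lam ^ r * mu ^ (Suc l - r) / mu)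
        \<le> 1 * (real (Suc l choose r) * lam ^ r * mu ^ (Suc l - r) / mu)"
      using assms by (intro mult_right_mono q) auto
    moreover have "0 \<le> real (Suc l choose r) * lam ^ r * mu ^ (Suc l - r) / mu" using assms by simp
    ultimately show "\<bar>ballot_coeff lam mu i k l r\<bar> \<le> real (Suc l choose r) * lam ^ r * mu ^ (Suc l - r) / mu"
      using assms unfolding ballot_coeff_def p by (auto simp: abs_mult mult_ac simp del: binomial_Suc_Suc)
  qed
  also have "\<dots> = (lam + mu) ^ Suc l / mu"
    unfolding binomial_ring[of lam mu] by (simp only: sum_divide_distrib)
  finally show ?thesis by (simp add: mult.commute)
qed

text \<open>The difference of binomials is at most 2^l, hence at most 2^l C(l, r) for r \<le> l.
  This crude factor is harmless, since any geometric growth rate is admissible.\<close>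

lemma sum_abs_reflection_coeff_le:
  assumes "0 < lam" "0 < mu"
  shows "(\<Sum>r\<le>l + i. \<bar>reflection_coeff lam mu i k l r\<bar>) \<le> (2 * (lam + mu)) ^ l"
proof -
  have "(\<Sum>r\<le>l + i. \<bar>reflection_coeff lam mu i k l r\<bar>) = (\<Sum>r\<le>l. \<bar>reflection_coeff lam mu i k l r\<bar>)"
    by (rule sum.mono_neutral_right) (auto simp: reflection_coeff_def binomial_eq_0)
  also have "\<dots> \<le> (\<Sum>r\<le>l. 2 ^ l * (real (l choose r) * mu ^ r * lam ^ (l - r)))"
  proof (intro sum_mono)
    fix r assume r: "r \<in> {..l}"
    have le2: "real (l choose j) \<le> 2 ^ l" for j
      using binomial_le_pow2[of l j] by (metis of_nat_le_iff of_nat_numeral of_nat_power)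
    have "\<bar>real (l choose r) - real (l choose (k + r))\<bar> \<le> 2 ^ l"
      using le2[of r] le2[of "k + r"] of_nat_0_le_iff[of "l choose r", where 'a = real] of_nat_0_le_iff[of "l choose (k + r)", where 'a = real]
      by linarith
    moreover have "1 \<le> real (l choose r)" using r by (simp add: Suc_leI)
    ultimately have "\<bar>real (l choose r) - real (l choose (k + r))\<bar> * 1 \<le> 2 ^ l * real (l choose r)"
      by (intro mult_mono) auto
    then have "\<bar>real (l choose r) - real (l choose (k + r))\<bar> * (mu ^ r * lam ^ (l - r)) \<le>
        2 ^ l * real (l choose r) * (mu ^ r * lam ^ (l - r))"
      using assms by (intro mult_right_mono) auto
    moreover have "lam powi (int l - int r) = lam ^ (l - r)" using r by (simp add: power_int_def nat_diff_distrib)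
    ultimately show "\<bar>reflection_coeff lam mu i k l r\<bar> \<le> 2 ^ l * (real (l choose r) * mu ^ r * lam ^ (l - r))"
      using assms by (auto simp: reflection_coeff_def abs_mult mult_ac)
  qed
  also have "\<dots> = (2 * (lam + mu)) ^ l"
    unfolding power_mult_distrib add.commute[of lam mu] binomial_ring[of mu lam] sum_distrib_left ..
  finally show ?thesis .
qed

section \<open>Identification with the stated series\<close>

lemma int_binomial_of_nat: "int_binomial (int n) j = real (n choose j)"
proof (cases "j \<le> n")
  case True
  have "nat (int n - int j) = n - j" by linarith
  then show ?thesis using True binomial_fact[OF True, where 'a = real]
    by (simp add: int_binomial_def inv_fact_def)
qed (simp add: int_binomial_def inv_fact_def binomial_eq_0)

lemma int_binomial_neg: "n < 0 \<Longrightarrow> int_binomial n j = 0"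
  by (simp add: int_binomial_def inv_fact_def)

theorem theorem2p4:
  fixes \<alpha> lam mu t :: real and i k :: nat
    and M :: "'a measure" and N :: "real \<Rightarrow> 'a \<Rightarrow> nat"
  assumes "0 < \<alpha>" "\<alpha> \<le> 1" and "lam > 0" and "mu > 0" and "lam \<noteq> mu"
    and "fractional_MM1_queue M N \<alpha> lam mu i"
    and "t \<ge> 0"
  shows
    "let A = (\<lambda>r. \<Sum>m=0..k+r+i.
               (real r - real m) / (real r + real m) * real ((r + m) choose r)
               * lam ^ r * mu powi (int m - 1)
               * time_pow t (\<alpha> * real (r + m) - \<alpha>)
               * mittag_leffler \<alpha> (\<alpha> * real (r + m) - \<alpha> + 1) (real (r + m))
                   (- (lam + mu) * time_pow t \<alpha>));
         B = (\<lambda>r. (int_binomial (int k + 2 * int r - int i) r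
                   - int_binomial (int k + 2 * int r - int i) (k + r))
               * lam powi (int k + int r - int i) * mu ^ r
               * time_pow t (\<alpha> * real_of_int (int k + 2 * int r - int i))
               * mittag_leffler \<alpha> (\<alpha> * real_of_int (int k + 2 * int r - int i) + 1)
                   (real_of_int (int k + 2 * int r - int i + 1))
                   (- (lam + mu) * time_pow t \<alpha>))
     in summable A \<and> summable B \<and>
        state_prob M N i k t =
          (1 - lam / mu) * (lam / mu) ^ k + (lam / mu) ^ k * (\<Sum>r. A r) + (\<Sum>r. B r)"
proof -
  let ?A = "\<lambda>r. \<Sum>m=0..k+r+i.
               (real r - real m) / (real r + real m) * real ((r + m) choose r)
               * lam ^ r * mu powi (int m - 1)
               * time_pow t (\<alpha> * real (r + m) - \<alpha>)
               * mittag_leffler \<alpha> (\<alpha> * real (r + m) - \<alpha> + 1) (real (r + m))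
                   (- (lam + mu) * time_pow t \<alpha>)"
  let ?B = "\<lambda>r. (int_binomial (int k + 2 * int r - int i) r
                   - int_binomial (int k + 2 * int r - int i) (k + r))
               * lam powi (int k + int r - int i) * mu ^ r
               * time_pow t (\<alpha> * real_of_int (int k + 2 * int r - int i))
               * mittag_leffler \<alpha> (\<alpha> * real_of_int (int k + 2 * int r - int i) + 1)
                   (real_of_int (int k + 2 * int r - int i + 1))
                   (- (lam + mu) * time_pow t \<alpha>)"
  define a where "a = lam + mu"
  have a: "0 \<le> a" using assms by (simp add: a_def)
  define F where "F = ml_term \<alpha> a t"
  define va where "va l = (\<Sum>r\<le>Suc l. ballot_coeff lam mu i k l r)" for l
  define vb where "vb l = (\<Sum>r\<le>l + i. reflection_coeff lam mu i k l r)" for l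
  have va_le: "\<bar>va l\<bar> \<le> a / mu * a ^ l" for l
    unfolding va_def a_def using sum_abs_ballot_coeff_le[OF assms(3,4)] by (rule order_trans[OF sum_abs])
  have vb_le: "\<bar>vb l\<bar> \<le> (2 * a) ^ l" for l
    unfolding vb_def a_def using sum_abs_reflection_coeff_le[OF assms(3,4)] by (rule order_trans[OF sum_abs])

  \<comment> \<open>With l = r + m - 1, these are the \<open>l\<close> for which m = l + 1 - r lies
    between 0 and k + r + i.\<close>
  let ?LA = "\<lambda>r. {l. r \<le> Suc l \<and> Suc l \<le> k + 2 * r + i}"
  let ?LB = "\<lambda>r. {l. int l = int k + 2 * int r - int i}"
  have A_eq: "?A r = (\<Sum>l\<in>?LA r. ballot_coeff lam mu i k l r * F l)" for r
  proof -
    let ?X = "\<lambda>m. (real r - real m) / (real r + real m) * real ((r + m) choose r)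
               * lam ^ r * mu powi (int m - 1)
               * time_pow t (\<alpha> * real (r + m) - \<alpha>)
               * mittag_leffler \<alpha> (\<alpha> * real (r + m) - \<alpha> + 1) (real (r + m))
                   (- (lam + mu) * time_pow t \<alpha>)"
    \<comment> \<open>The term r = m = 0 is 0 and must be removed first: it would correspond to l =
      -1, which natural subtraction sends to 0.\<close>
    have "?A r = (\<Sum>m\<in>{m. m \<le> k + r + i \<and> 0 < r + m}. ?X m)"
      by (rule sum.mono_neutral_right) auto
    also have "\<dots> = (\<Sum>l\<in>?LA r. ballot_coeff lam mu i k l r * F l)"
    proof (rule sum.reindex_bij_witness[where i = "\<lambda>l. Suc l - r" and j = "\<lambda>m. r + m - 1"])
      fix m assume m: "m \<in> {m. m \<le> k + r + i \<and> 0 < r + m}"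
      define l where "l = r + m - 1"
      have l: "r + m = Suc l" "m = Suc l - r" "r \<le> Suc l" "Suc l \<le> k + 2 * r + i" using m by (auto simp: l_def)
      have F: "F l = time_pow t (\<alpha> * real (Suc l) - \<alpha>) * mittag_leffler \<alpha> (\<alpha> * real (Suc l) - \<alpha> + 1) (real (Suc l)) (- (lam + mu) * time_pow t \<alpha>)"
        by (simp add: F_def ml_term_def a_def algebra_simps)
      show "ballot_coeff lam mu i k (r + m - 1) r * F (r + m - 1) = ?X m"
        unfolding l_def[symmetric] unfolding F ballot_coeff_def l(1) using l by simp
    qed auto
    finally show ?thesis .
  qed
  have B_eq: "?B r = (\<Sum>l\<in>?LB r. reflection_coeff lam mu i k l r * F l)" for r
  \<comment> \<open>A negative index makes both binomials vanish and leaves no natural number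
    \<open>l\<close>, so both sides are 0.\<close>
  proof (cases "int k + 2 * int r - int i < 0")
    case True
    then have "?LB r = {}" by auto
    then show ?thesis using True by (simp add: int_binomial_neg)
  next
    case False
    then obtain l where l: "int k + 2 * int r - int i = int l" by (metis nat_0_le not_less)
    then have "?LB r = {l}" and e: "int k + int r - int i = int l - int r" by auto
    then show ?thesis
      unfolding e l int_binomial_of_nat
      by (simp add: reflection_coeff_def l F_def ml_term_def a_def add.commute)
  qed

  have A_sums: "?A sums (\<Sum>l. va l * F l)"
    unfolding A_eq va_def F_def
  proof (rule ml_term_rearranged[OF assms(1) a assms(7) a])
    show "(\<Sum>r\<le>Suc l. \<bar>ballot_coeff lam mu i k l r\<bar>) \<le> a / mu * a ^ l" for l
      using sum_abs_ballot_coeff_le[OF assms(3,4)] by (simp add: a_def)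
    show "finite (?LA r)" for r by (rule finite_subset[of _ "{..k + 2 * r + i}"]) auto
  qed (auto simp: ballot_coeff_def)
  have B_sums: "?B sums (\<Sum>l. vb l * F l)"
    unfolding B_eq vb_def F_def
  proof (rule ml_term_rearranged[OF assms(1) a assms(7)])
    show "(\<Sum>r\<le>l + i. \<bar>reflection_coeff lam mu i k l r\<bar>) \<le> 1 * (2 * a) ^ l" for l
      using sum_abs_reflection_coeff_le[OF assms(3,4)] by (simp add: a_def)
    show "finite (?LB r)" for r by (rule finite_subset[of _ "{..k + 2 * r}"]) auto
  qed (use a in \<open>auto simp: reflection_coeff_def\<close>)

  define x where "x = (1 - lam / mu) * (lam / mu) ^ k"
  define y where "y = (lam / mu) ^ k"
  have y: "0 \<le> y" using assms by (simp add: y_def)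
  have h: "queue_paths lam mu i l (int k) = x * a ^ l + y * va l + vb l" for l
    using queue_paths_eq_sum_coeffs[of mu lam i l k] assms by (simp add: x_def y_def va_def vb_def a_def)
  \<comment> \<open>The rate \<open>2 * a\<close> covers all three parts; the constant adds |x| for
    the powers of \<open>a\<close>, \<open>y * (a / mu)\<close> for \<open>va\<close> and 1 for
    \<open>vb\<close>.\<close>
  have h_le: "\<bar>queue_paths lam mu i l (int k)\<bar> \<le> (\<bar>x\<bar> + y * (a / mu) + 1) * (2 * a) ^ l" for l
  proof -
    have al: "a ^ l \<le> (2 * a) ^ l" using a by (intro power_mono) auto
    have "\<bar>queue_paths lam mu i l (int k)\<bar> \<le> \<bar>x * a ^ l\<bar> + \<bar>y * va l\<bar> + \<bar>vb l\<bar>" unfolding h by linarith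
    also have "\<bar>x * a ^ l\<bar> \<le> \<bar>x\<bar> * (2 * a) ^ l"
      using a al by (simp add: abs_mult mult_left_mono)
    also have "\<bar>y * va l\<bar> \<le> y * (a / mu * (2 * a) ^ l)"
    proof -
      have "a / mu * a ^ l \<le> a / mu * (2 * a) ^ l" using al a assms by (intro mult_left_mono) auto
      with va_le[of l] have "\<bar>va l\<bar> \<le> a / mu * (2 * a) ^ l" by (rule order_trans)
      from mult_left_mono[OF this y] y show ?thesis by (simp only: abs_mult abs_of_nonneg)
    qed
    also note vb_le[of l]
    finally show ?thesis by (simp add: algebra_simps)
  qed

  have "summable (\<lambda>l. va l * F l)"
    unfolding F_def by (rule sums_summable[OF ml_term_sums(2)[OF assms(1) a assms(7) a va_le]])
  moreover have "summable (\<lambda>l. vb l * F l)"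
    unfolding F_def
    by (rule sums_summable[OF ml_term_sums(2)[OF assms(1) a assms(7), where K = 1 and H = "2 * a"]])
      (use vb_le a in simp_all)
  moreover have "(\<lambda>l. a ^ l * F l) sums 1"
    unfolding F_def by (rule ml_term_sums_one[OF assms(1) a assms(7)])
  \<comment> \<open>The constant \<open>x\<close> of the theorem enters as \<open>x\<close> times
    the series with sum 1.\<close>
  ultimately have "(\<lambda>l. x * (a ^ l * F l) + y * (va l * F l) + vb l * F l) sums
      (x * 1 + y * (\<Sum>l. va l * F l) + (\<Sum>l. vb l * F l))"
    by (intro sums_add sums_mult summable_sums)
  then have "(\<lambda>l. queue_paths lam mu i l (int k) * F l) sums
      (x + y * (\<Sum>l. va l * F l) + (\<Sum>l. vb l * F l))"
    unfolding h by (simp add: algebra_simps)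
  \<comment> \<open>The same series, regrouped by fractional monomials, is the expansion of the
    state probability.\<close>
  moreover have "(\<lambda>l. queue_paths lam mu i l (int k) * F l) sums
      (\<Sum>n. binomial_transform a (\<lambda>l. queue_paths lam mu i l (int k)) n * frac_monom \<alpha> n t)"
    unfolding F_def by (rule ml_term_sums(2)[OF assms(1) a assms(7) _ h_le]) (use a in simp)
  moreover have "(\<Sum>n. binomial_transform a (\<lambda>l. queue_paths lam mu i l (int k)) n * frac_monom \<alpha> n t) = state_prob M N i k t"
    using state_prob_sums[OF assms(1-4,6,7), of k] by (simp add: a_def sums_iff)
  ultimately have "state_prob M N i k t = x + y * (\<Sum>l. va l * F l) + (\<Sum>l. vb l * F l)"
    by (metis sums_unique2)
  then show ?thesis
    unfolding Let_def x_def y_def using A_sums B_sums by (simp only: sums_iff)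
qed

end
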